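(* Let $\mathcal{T}$ be the translation from the $\pi$-calculus with implicit matching ($\pi_{\rm IM}$) to $\mathrm{CCS}_\gamma$ described in the context. Then for every $\pi_{\rm IM}$ process $P$ one has $\mathcal{T}(P) \stackrel{\bullet}{\sim} P$, i.e. $P$ and $\mathcal{T}(P)$ are strongly barbed bisimilar (as states of the disjoint union of the barbed transition systems of $\pi_{\rm IM}$ and $\mathrm{CCS}_\gamma$).
   Context: \textbf{Source language $\pi_{\rm IM}$.} Fix an infinite set $\mathcal{N}$ of names and, for each $n$, a set $\mathcal{K}_n$ of agent identifiers of arity $n$. A matching sequence $M$ is a finite (possibly empty) sequence of matches $[x{=}y]$ with $x\neq y$; $\mathrm{n}(M)$ is the set of names in $M$. Processes: $\mathbf{0}$, $M\tau.P$, $M\bar{x}y.P$, $Mx(y).P$ (binding $y$ in $P$), $(\nu y)P$ (binding $y$), $P|Q$, $P+Q$, $A(y_1,\dots,y_n)$ with $A\in\mathcal{K}_n$. Each $A\in\mathcal{K}_n$ has a unique defining equation $A(x_1,\dots,x_n)\stackrel{\rm def}{=}P$ with the $x_i$ distinct and the free names of $P$ among $x_1,\dots,x_n$. Its semantics is the standard (late) labelled transition semantics of the $\pi$-calculus (Milner–Parrow–Walker: rules for prefixes, sum, defined agents, parallel with side condition on bound names, communication com and close, restriction and open), with labels $\tau$, $\bar xy$, $\bar x(y)$, $x(y)$, where only prefixes with empty matching sequence $M$ can fire; a prefix $M\alpha.P$ with $M$ nonempty has no transitions. Reductions of a $\pi_{\rm IM}$ process are its $\tau$-transitions; $P\downarrow_x$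 iff $P$ has an input transition on $x$, and $P\downarrow_{\bar x}$ iff $P$ has a (free or bound) output transition on $x$. \textbf{Names for the target.} Let $p\notin\mathcal{N}$, $\mathcal{P}_0=\{{}^{\varsigma}p\mid \varsigma\in\{e,\ell,r\}^*\}$ and $\mathcal{P}=\{u^{\upsilon}\mid u\in\mathcal{P}_0,\ \upsilon\in\{'\}^*\}$ (private names). Let $\mathcal{S}=\{s_1,s_2,\dots\}$ be a set of spare names disjoint from $\mathcal{N}$ and $\mathcal{P}$. Let $\mathcal{Z}=\mathcal{N}\uplus\mathcal{S}$ (public names) and $\mathcal{M}=\mathcal{Z}\uplus\mathcal{P}$. Actions are $M\tau$, $M\bar x y$, $Mxy$ with $x,y\in\mathcal{M}$ and $M$ a matching sequence over $\mathcal{M}$; $\tau$ denotes $M\tau$ with $M$ empty. \textbf{Target language $\mathrm{CCS}_\gamma$.} Processes: $\alpha.E$, $\sum_{i\in I}E_i$ (with $\mathbf 0$ the empty sum and $+$ binary sum), $E\|F$, $E[f]$, and agent identifiers $A$ with defining equations $A=E$. Rules: $\alpha.E\xrightarrow{\alpha}E$; a sum does what a summand does; $E\|F$ interleaves, and if $E\xrightarrow{a}E'$, $F\xrightarrow{b}F'$ and $\gamma(a,b)=c$ then $E\|F\xrightarrow{c}E'\|F'$; if $E\xrightarrow{\alpha}E'$ then $E[f]\xrightarrow{f(\alpha)}E'[f]$; $A$ does what its body does. The communication function is $\gamma(M\bar xy,Nvy)=\gamma(Nvy,M\bar xy)=[x{=}v]MN\tau$, undefined otherwise, where prepending $[x{=}x]$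 means prepending nothing. A substitution $\sigma$ (partial map $\mathcal{M}\rightharpoonup\mathcal{M}$, identity outside its domain) acts as a relabelling by applying $\sigma$ to every name of an action, dropping resulting matches $[y{=}y]$. Reductions are $\tau$-transitions; for $a\in\mathcal{Z}$, $E\downarrow_a$ iff $E\xrightarrow{ay}$ for some $y$ and $E\downarrow_{\bar a}$ iff $E\xrightarrow{\bar ay}$ for some $y$ (labels with empty matching sequence only; private names give no barbs). \textbf{Substitutions used.} For distinct $x_1,\dots,x_n\in\mathcal{N}$ and $y_1,\dots,y_n\in\mathcal{M}$, $\{\vec y/\vec x\}^{\mathcal S}$ maps $x_i\mapsto y_i$, $s_i\mapsto x_i$ ($1\le i\le n$), $s_i\mapsto s_{i-n}$ ($i>n$); write $\{z/y\}^{\mathcal S}$ for $n=1$. For $\eta\in\{\ell,r,e\}$: $\eta({}^{\varsigma}p)={}^{\eta\varsigma}p$ and $\eta({}^{\varsigma}p^{\upsilon\prime})={}^{\varsigma}p^{\upsilon}$ if $\varsigma$ does not begin with $\eta$, identity elsewhere. For $y\in\mathcal{Z}$: $p_y(y)=p$, $p_y(p')=y$, $p_y(u)=e(u)$ for $u\in\mathcal{P}\setminus\{p'\}$, identity elsewhere. \textbf{Translation.} $\mathcal{T}(\mathbf 0)=\mathbf 0$; $\mathcal{T}(M\tau.P)=M\tau.\mathcal{T}(P)$; $\mathcal{T}(M\bar xy.P)=M\bar xy.\mathcal{T}(P)$; $\mathcal{T}(Mx(y).P)=\sum_{z\in\mathcal M}Mxz.(\mathcal{T}(P)[\{z/y\}^{\mathcal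 S}])$; $\mathcal{T}((\nu y)P)=\mathcal{T}(P)[p_y]$; $\mathcal{T}(P|Q)=\mathcal{T}(P)[\ell]\,\|\,\mathcal{T}(Q)[r]$; $\mathcal{T}(P+Q)=\mathcal{T}(P)+\mathcal{T}(Q)$; $\mathcal{T}(A(\vec y))=A[\{\vec y/\vec x\}^{\mathcal S}]$ where $A(\vec x)\stackrel{\rm def}{=}P$ and the $\mathrm{CCS}_\gamma$ identifier $A$ has defining equation $A=\mathcal{T}(P)$. \textbf{Strong barbed bisimilarity.} A symmetric relation $\mathcal R$ on states (of the disjoint union of both systems) such that $P\mathcal RQ$ and $P\to P'$ (reduction) imply $Q\to Q'$ with $P'\mathcal RQ'$, and $P\mathcal RQ$, $P\downarrow_b$ imply $Q\downarrow_b$; $\stackrel{\bullet}{\sim}$ is the union of all such relations. *)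

theory Defs
  imports Main
begin

section \<open>Matching sequences\<close>

text \<open>
  The list \<open>[(x\<^sub>1,y\<^sub>1), \<dots>, (x\<^sub>n,y\<^sub>n)]\<close> encodes the matching sequence
  \<open>[x\<^sub>1=y\<^sub>1]\<dots>[x\<^sub>n=y\<^sub>n]\<close>. The proviso that the two names of a match differ is
  \<open>proper\<close>; every operation below discards the matches \<open>[x=x]\<close> it creates.
\<close>

type_synonym 'm matching = "('m \<times> 'm) list"

definition proper :: "'m matching \<Rightarrow> bool" where
  "proper M \<longleftrightarrow> (\<forall>(x, y) \<in> set M. x \<noteq> y)"

definition match_names :: "'m matching \<Rightarrow> 'm set" where
  "match_names M = fst ` set M \<union> snd ` set M"

definition match_map :: "('m \<Rightarrow> 'm') \<Rightarrow> 'm matching \<Rightarrow> 'm' matching" where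
  "match_map \<sigma> M = filter (\<lambda>(x, y). x \<noteq> y) (map (\<lambda>(x, y). (\<sigma> x, \<sigma> y)) M)"

definition add_match :: "'m \<Rightarrow> 'm \<Rightarrow> 'm matching \<Rightarrow> 'm matching" where
  "add_match x y M = (if x = y then M else (x, y) # M)"


section \<open>The pi-calculus with implicit matching\<close>

datatype ('n, 'k) proc =
    Null
  | TauPre "'n matching" "('n, 'k) proc"
  | OutPre "'n matching" 'n 'n "('n, 'k) proc"
  | InPre "'n matching" 'n 'n "('n, 'k) proc"
  | Nu 'n "('n, 'k) proc"
  | Par "('n, 'k) proc" "('n, 'k) proc"
  | Plus "('n, 'k) proc" "('n, 'k) proc"
  | Call 'k "'n list"

text \<open>
  \<open>D A = (xs, P)\<close> encodes the defining equation \<open>A(xs) = P\<close>; the arity of \<open>A\<close> is \<open>length xs\<close>.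
\<close>

type_synonym ('n, 'k) defs = "'k \<Rightarrow> 'n list \<times> ('n, 'k) proc"

primrec fnames :: "('n, 'k) proc \<Rightarrow> 'n set" where
  "fnames Null = {}"
| "fnames (TauPre M P) = match_names M \<union> fnames P"
| "fnames (OutPre M x y P) = match_names M \<union> {x, y} \<union> fnames P"
| "fnames (InPre M x y P) = match_names M \<union> {x} \<union> (fnames P - {y})"
| "fnames (Nu y P) = fnames P - {y}"
| "fnames (Par P Q) = fnames P \<union> fnames Q"
| "fnames (Plus P Q) = fnames P \<union> fnames Q"
| "fnames (Call A ys) = set ys"

primrec wf_proc :: "('n, 'k) defs \<Rightarrow> ('n, 'k) proc \<Rightarrow> bool" where
  "wf_proc D Null \<longleftrightarrow> True"
| "wf_proc D (TauPre M P) \<longleftrightarrow> proper M \<and> wf_proc D P"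
| "wf_proc D (OutPre M x y P) \<longleftrightarrow> proper M \<and> wf_proc D P"
| "wf_proc D (InPre M x y P) \<longleftrightarrow> proper M \<and> wf_proc D P"
| "wf_proc D (Nu y P) \<longleftrightarrow> wf_proc D P"
| "wf_proc D (Par P Q) \<longleftrightarrow> wf_proc D P \<and> wf_proc D Q"
| "wf_proc D (Plus P Q) \<longleftrightarrow> wf_proc D P \<and> wf_proc D Q"
| "wf_proc D (Call A ys) \<longleftrightarrow> length ys = length (fst (D A))"

definition wf_defs :: "('n, 'k) defs \<Rightarrow> bool" where
  "wf_defs D \<longleftrightarrow> (\<forall>A. distinct (fst (D A)) \<and> fnames (snd (D A)) \<subseteq> set (fst (D A))
                      \<and> wf_proc D (snd (D A)))"

text \<open>
  A binder \<open>y\<close> with scope \<open>P\<close> is kept by a substitution \<open>\<sigma>\<close> unless \<open>\<sigma>\<close> maps some other free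
  name of \<open>P\<close> to \<open>y\<close>, in which case it is renamed to a name that avoids capture. Such a name
  exists when there are infinitely many names.
\<close>

definition new_binder :: "('n \<Rightarrow> 'n) \<Rightarrow> 'n \<Rightarrow> ('n, 'k) proc \<Rightarrow> 'n" where
  "new_binder \<sigma> y P =
     (if y \<notin> \<sigma> ` (fnames P - {y}) then y else (SOME z. z \<notin> \<sigma> ` (fnames P - {y})))"

primrec subst :: "('n, 'k) proc \<Rightarrow> ('n \<Rightarrow> 'n) \<Rightarrow> ('n, 'k) proc" where
  "subst Null \<sigma> = Null"
| "subst (TauPre M P) \<sigma> = TauPre (match_map \<sigma> M) (subst P \<sigma>)"
| "subst (OutPre M x y P) \<sigma> = OutPre (match_map \<sigma> M) (\<sigma> x) (\<sigma> y) (subst P \<sigma>)"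
| "subst (InPre M x y P) \<sigma> =
     (let z = new_binder \<sigma> y P in InPre (match_map \<sigma> M) (\<sigma> x) z (subst P (\<sigma>(y := z))))"
| "subst (Nu y P) \<sigma> = (let z = new_binder \<sigma> y P in Nu z (subst P (\<sigma>(y := z))))"
| "subst (Par P Q) \<sigma> = Par (subst P \<sigma>) (subst Q \<sigma>)"
| "subst (Plus P Q) \<sigma> = Plus (subst P \<sigma>) (subst Q \<sigma>)"
| "subst (Call A ys) \<sigma> = Call A (map \<sigma> ys)"

text \<open>\<open>subst1 P w y\<close> is \<open>P{w/y}\<close> and \<open>subst_list P xs ys\<close> is \<open>P{ys/xs}\<close>.\<close>

definition subst1 :: "('n, 'k) proc \<Rightarrow> 'n \<Rightarrow> 'n \<Rightarrow> ('n, 'k) proc" where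
  "subst1 P w y = subst P (id(y := w))"

definition subst_list :: "('n, 'k) proc \<Rightarrow> 'n list \<Rightarrow> 'n list \<Rightarrow> ('n, 'k) proc" where
  "subst_list P xs ys =
     subst P (\<lambda>x. case map_of (zip xs ys) x of Some y \<Rightarrow> y | None \<Rightarrow> x)"

text \<open>The labels are \<open>\<tau>\<close>, free output, bound output and (late) input.\<close>

datatype 'n label = LTau | LOut 'n 'n | LBOut 'n 'n | LIn 'n 'n

primrec bn :: "'n label \<Rightarrow> 'n set" where
  "bn LTau = {}"
| "bn (LOut x y) = {}"
| "bn (LBOut x y) = {y}"
| "bn (LIn x y) = {y}"

primrec label_names :: "'n label \<Rightarrow> 'n set" where
  "label_names LTau = {}"
| "label_names (LOut x y) = {x, y}"
| "label_names (LBOut x y) = {x, y}"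
| "label_names (LIn x y) = {x, y}"

inductive pi_trans :: "('n, 'k) defs \<Rightarrow> ('n, 'k) proc \<Rightarrow> 'n label \<Rightarrow> ('n, 'k) proc \<Rightarrow> bool"
  for D :: "('n, 'k) defs" where
  tau: "pi_trans D (TauPre [] P) LTau P"
| out: "pi_trans D (OutPre [] x y P) (LOut x y) P"
| inp: "w \<notin> fnames (Nu y P) \<Longrightarrow> pi_trans D (InPre [] x y P) (LIn x w) (subst1 P w y)"
| sum1: "pi_trans D P \<alpha> P' \<Longrightarrow> pi_trans D (Plus P Q) \<alpha> P'"
| sum2: "pi_trans D Q \<alpha> Q' \<Longrightarrow> pi_trans D (Plus P Q) \<alpha> Q'"
| ide: "D A = (xs, P) \<Longrightarrow> pi_trans D (subst_list P xs ys) \<alpha> P' \<Longrightarrow> pi_trans D (Call A ys) \<alpha> P'"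
| par1: "pi_trans D P \<alpha> P' \<Longrightarrow> bn \<alpha> \<inter> fnames Q = {} \<Longrightarrow> pi_trans D (Par P Q) \<alpha> (Par P' Q)"
| par2: "pi_trans D Q \<alpha> Q' \<Longrightarrow> bn \<alpha> \<inter> fnames P = {} \<Longrightarrow> pi_trans D (Par P Q) \<alpha> (Par P Q')"
| com1: "pi_trans D P (LOut x y) P' \<Longrightarrow> pi_trans D Q (LIn x z) Q'
    \<Longrightarrow> pi_trans D (Par P Q) LTau (Par P' (subst1 Q' y z))"
| com2: "pi_trans D P (LIn x z) P' \<Longrightarrow> pi_trans D Q (LOut x y) Q'
    \<Longrightarrow> pi_trans D (Par P Q) LTau (Par (subst1 P' y z) Q')"
| close1: "pi_trans D P (LBOut x w) P' \<Longrightarrow> pi_trans D Q (LIn x w) Q'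
    \<Longrightarrow> pi_trans D (Par P Q) LTau (Nu w (Par P' Q'))"
| close2: "pi_trans D P (LIn x w) P' \<Longrightarrow> pi_trans D Q (LBOut x w) Q'
    \<Longrightarrow> pi_trans D (Par P Q) LTau (Nu w (Par P' Q'))"
| res: "pi_trans D P \<alpha> P' \<Longrightarrow> y \<notin> label_names \<alpha> \<Longrightarrow> pi_trans D (Nu y P) \<alpha> (Nu y P')"
| opn: "pi_trans D P (LOut x y) P' \<Longrightarrow> y \<noteq> x \<Longrightarrow> w \<notin> fnames (Nu y P')
    \<Longrightarrow> pi_trans D (Nu y P) (LBOut x w) (subst1 P' w y)"


section \<open>CCS with a communication function\<close>

text \<open>
  Parameters: a type \<open>'a\<close> of actions, a type \<open>'k\<close> of agent identifiers and a type \<open>'i\<close> providing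
  the index sets of sums. \<open>Sum F\<close> is the sum of the \<open>E\<close> with \<open>F i = Some E\<close>, \<open>i\<close> ranging over
  the index set \<open>dom F\<close>.
\<close>

datatype ('a, 'k, 'i) ccs =
    Prefix 'a "('a, 'k, 'i) ccs"
  | Sum "'i \<Rightarrow> ('a, 'k, 'i) ccs option"
  | CPar "('a, 'k, 'i) ccs" "('a, 'k, 'i) ccs"
  | Relabel "('a, 'k, 'i) ccs" "'a \<Rightarrow> 'a"
  | Ident 'k

inductive ccs_trans :: "('a \<Rightarrow> 'a \<Rightarrow> 'a option) \<Rightarrow> ('k \<Rightarrow> ('a, 'k, 'i) ccs)
    \<Rightarrow> ('a, 'k, 'i) ccs \<Rightarrow> 'a \<Rightarrow> ('a, 'k, 'i) ccs \<Rightarrow> bool"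
  for \<gamma> :: "'a \<Rightarrow> 'a \<Rightarrow> 'a option" and \<Delta> :: "'k \<Rightarrow> ('a, 'k, 'i) ccs" where
  prefix: "ccs_trans \<gamma> \<Delta> (Prefix a E) a E"
| sum: "F i = Some E \<Longrightarrow> ccs_trans \<gamma> \<Delta> E a E' \<Longrightarrow> ccs_trans \<gamma> \<Delta> (Sum F) a E'"
| left: "ccs_trans \<gamma> \<Delta> E a E' \<Longrightarrow> ccs_trans \<gamma> \<Delta> (CPar E F) a (CPar E' F)"
| right: "ccs_trans \<gamma> \<Delta> F a F' \<Longrightarrow> ccs_trans \<gamma> \<Delta> (CPar E F) a (CPar E F')"
| comm: "ccs_trans \<gamma> \<Delta> E a E' \<Longrightarrow> ccs_trans \<gamma> \<Delta> F b F' \<Longrightarrow> \<gamma> a b = Some c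
    \<Longrightarrow> ccs_trans \<gamma> \<Delta> (CPar E F) c (CPar E' F')"
| relabel: "ccs_trans \<gamma> \<Delta> E a E' \<Longrightarrow> ccs_trans \<gamma> \<Delta> (Relabel E f) (f a) (Relabel E' f)"
| ident: "ccs_trans \<gamma> \<Delta> (\<Delta> A) a E' \<Longrightarrow> ccs_trans \<gamma> \<Delta> (Ident A) a E'"


section \<open>Names and actions of the target language\<close>

datatype tag = TagE | TagL | TagR

text \<open>
  \<open>Spare i\<close> is the spare name \<open>s\<^sub>i\<^sub>+\<^sub>1\<close> (indices are shifted to start at 0), and
  \<open>Priv \<rho> k\<close> is the private name \<open>p\<close> decorated with the string \<open>\<rho>\<close> on its left and
  with \<open>k\<close> primes on its right.
\<close>

datatype 'n name = Name 'n | Spare nat | Priv "tag list" nat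

definition public :: "'n name set" where
  "public = range Name \<union> range Spare"

datatype 'm action =
    ATau "'m matching"
  | AOut "'m matching" 'm 'm
  | AIn "'m matching" 'm 'm

fun gam :: "'m action \<Rightarrow> 'm action \<Rightarrow> 'm action option" where
  "gam (AOut M x y) (AIn N v y') =
     (if y = y' then Some (ATau (add_match x v (M @ N))) else None)"
| "gam (AIn N v y') (AOut M x y) =
     (if y = y' then Some (ATau (add_match x v (M @ N))) else None)"
| "gam _ _ = None"

primrec act_map :: "('m \<Rightarrow> 'm) \<Rightarrow> 'm action \<Rightarrow> 'm action" where
  "act_map \<sigma> (ATau M) = ATau (match_map \<sigma> M)"
| "act_map \<sigma> (AOut M x y) = AOut (match_map \<sigma> M) (\<sigma> x) (\<sigma> y)"
| "act_map \<sigma> (AIn M x y) = AIn (match_map \<sigma> M) (\<sigma> x) (\<sigma> y)"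

text \<open>\<open>spare_subst xs ys\<close> is the substitution of \<open>ys\<close> for \<open>xs\<close> with superscript \<open>\<S>\<close>.\<close>

fun spare_subst :: "'n list \<Rightarrow> 'n name list \<Rightarrow> 'n name \<Rightarrow> 'n name" where
  "spare_subst xs ys (Name x) =
     (case map_of (zip xs ys) x of Some y \<Rightarrow> y | None \<Rightarrow> Name x)"
| "spare_subst xs ys (Spare i) =
     (if i < length xs then Name (xs ! i) else Spare (i - length xs))"
| "spare_subst xs ys (Priv \<rho> k) = Priv \<rho> k"

fun tag_map :: "tag \<Rightarrow> 'n name \<Rightarrow> 'n name" where
  "tag_map \<eta> (Priv \<rho> 0) = Priv (\<eta> # \<rho>) 0"
| "tag_map \<eta> (Priv \<rho> (Suc k)) =
     (if \<rho> \<noteq> [] \<and> hd \<rho> = \<eta> then Priv \<rho> (Suc k) else Priv \<rho> k)"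
| "tag_map \<eta> u = u"

text \<open>This is the map \<open>p\<^sub>y\<close>. Note that \<open>tag_map\<close> is the identity on public names.\<close>

definition priv_map :: "'n name \<Rightarrow> 'n name \<Rightarrow> 'n name" where
  "priv_map y u =
     (if u = y then Priv [] 0 else if u = Priv [] 1 then y else tag_map TagE u)"


section \<open>The translation\<close>

text \<open>
  The index type \<open>'n name + bool\<close> accommodates the three sums needed: the empty one, the binary
  ones (indexed by the Booleans) and those indexed by the set of all names.
\<close>

type_synonym ('n, 'k) tccs = "('n name action, 'k, 'n name + bool) ccs"

definition empty_sum :: "('n, 'k) tccs" where
  "empty_sum = Sum (\<lambda>_. None)"

definition binary_sum :: "('n, 'k) tccs \<Rightarrow> ('n, 'k) tccs \<Rightarrow> ('n, 'k) tccs" where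
  "binary_sum E F = Sum (case_sum (\<lambda>_. None) (\<lambda>b. Some (if b then E else F)))"

definition name_sum :: "('n name \<Rightarrow> ('n, 'k) tccs) \<Rightarrow> ('n, 'k) tccs" where
  "name_sum E = Sum (case_sum (\<lambda>z. Some (E z)) (\<lambda>_. None))"

definition match_incl :: "'n matching \<Rightarrow> 'n name matching" where
  "match_incl M = map (map_prod Name Name) M"

primrec transl :: "('n, 'k) defs \<Rightarrow> ('n, 'k) proc \<Rightarrow> ('n, 'k) tccs" where
  "transl D Null = empty_sum"
| "transl D (TauPre M P) = Prefix (ATau (match_incl M)) (transl D P)"
| "transl D (OutPre M x y P) = Prefix (AOut (match_incl M) (Name x) (Name y)) (transl D P)"
| "transl D (InPre M x y P) =
     name_sum (\<lambda>z. Prefix (AIn (match_incl M) (Name x) z)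
                     (Relabel (transl D P) (act_map (spare_subst [y] [z]))))"
| "transl D (Nu y P) = Relabel (transl D P) (act_map (priv_map (Name y)))"
| "transl D (Par P Q) =
     CPar (Relabel (transl D P) (act_map (tag_map TagL)))
          (Relabel (transl D Q) (act_map (tag_map TagR)))"
| "transl D (Plus P Q) = binary_sum (transl D P) (transl D Q)"
| "transl D (Call A ys) = Relabel (Ident A) (act_map (spare_subst (fst (D A)) (map Name ys)))"

definition transl_defs :: "('n, 'k) defs \<Rightarrow> 'k \<Rightarrow> ('n, 'k) tccs" where
  "transl_defs D A = transl D (snd (D A))"


section \<open>Barbed transition systems and strong barbed bisimilarity\<close>

definition barbed_bisimulation ::
  "('s \<Rightarrow> 's \<Rightarrow> bool) \<Rightarrow> ('s \<Rightarrow> 'b \<Rightarrow> bool) \<Rightarrow> ('s \<Rightarrow> 's \<Rightarrow> bool) \<Rightarrow> bool" where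
  "barbed_bisimulation red barb R \<longleftrightarrow>
     symp R \<and>
     (\<forall>s t s'. R s t \<longrightarrow> red s s' \<longrightarrow> (\<exists>t'. red t t' \<and> R s' t')) \<and>
     (\<forall>s t b. R s t \<longrightarrow> barb s b \<longrightarrow> barb t b)"

definition barbed_bisimilar ::
  "('s \<Rightarrow> 's \<Rightarrow> bool) \<Rightarrow> ('s \<Rightarrow> 'b \<Rightarrow> bool) \<Rightarrow> 's \<Rightarrow> 's \<Rightarrow> bool" where
  "barbed_bisimilar red barb s t \<longleftrightarrow> (\<exists>R. barbed_bisimulation red barb R \<and> R s t)"

text \<open>Barbs are public names (input) and co-names of public names (output).\<close>

datatype 'm barb = InBarb 'm | OutBarb 'm

definition pi_red :: "('n, 'k) defs \<Rightarrow> ('n, 'k) proc \<Rightarrow> ('n, 'k) proc \<Rightarrow> bool" where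
  "pi_red D P P' \<longleftrightarrow> pi_trans D P LTau P'"

fun pi_barb :: "('n, 'k) defs \<Rightarrow> ('n, 'k) proc \<Rightarrow> 'n name barb \<Rightarrow> bool" where
  "pi_barb D P (InBarb a) \<longleftrightarrow> (\<exists>x y P'. a = Name x \<and> pi_trans D P (LIn x y) P')"
| "pi_barb D P (OutBarb a) \<longleftrightarrow>
     (\<exists>x y P'. a = Name x \<and> (pi_trans D P (LOut x y) P' \<or> pi_trans D P (LBOut x y) P'))"

definition ccs_red :: "('n, 'k) defs \<Rightarrow> ('n, 'k) tccs \<Rightarrow> ('n, 'k) tccs \<Rightarrow> bool" where
  "ccs_red D E E' \<longleftrightarrow> ccs_trans gam (transl_defs D) E (ATau []) E'"

fun ccs_barb :: "('n, 'k) defs \<Rightarrow> ('n, 'k) tccs \<Rightarrow> 'n name barb \<Rightarrow> bool" where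
  "ccs_barb D E (InBarb a) \<longleftrightarrow>
     a \<in> public \<and> (\<exists>y E'. ccs_trans gam (transl_defs D) E (AIn [] a y) E')"
| "ccs_barb D E (OutBarb a) \<longleftrightarrow>
     a \<in> public \<and> (\<exists>y E'. ccs_trans gam (transl_defs D) E (AOut [] a y) E')"

type_synonym ('n, 'k) state = "('n, 'k) proc + ('n, 'k) tccs"

inductive union_red :: "('n, 'k) defs \<Rightarrow> ('n, 'k) state \<Rightarrow> ('n, 'k) state \<Rightarrow> bool"
  for D :: "('n, 'k) defs" where
  "pi_red D P P' \<Longrightarrow> union_red D (Inl P) (Inl P')"
| "ccs_red D E E' \<Longrightarrow> union_red D (Inr E) (Inr E')"

fun union_barb :: "('n, 'k) defs \<Rightarrow> ('n, 'k) state \<Rightarrow> 'n name barb \<Rightarrow> bool" where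
  "union_barb D (Inl P) b \<longleftrightarrow> pi_barb D P b"
| "union_barb D (Inr E) b \<longleftrightarrow> ccs_barb D E b"

end

theory Submission imports Defs begin

text \<open>
  The relabellings of a translated process are all surjective, so whatever the context they build
  up, an input can still receive every name. They also split the unprimed private names:
  \<open>tag_map TagL\<close> and \<open>tag_map TagR\<close> hand disjoint halves of them to the components of a parallel
  composition, while \<open>p\<^sub>y\<close> uses one for \<open>y\<close> and passes on the others. So each component owns a
  supply of fresh names, and a restricted name extruded by one component can never clash with
  those owned by another.

  Hence a target process below a relabelling can be related to a source process by a relation that
  records how the free names of the source process are read as target names, and which names the
  target process owns. When a bound output on the source side closes the scope of a name, the
  target side records nothing but the private name used for it. The relation lets a restriction of
  the source process be backed by an owned name at any position, which absorbs the difference.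
  Transitions of the source process are matched without any assumption on the reading of
  its free names. Conversely, the implicit matches of the target force two names to be equal only
  after relabelling; if the reading of free names is injective and avoids the owned names, then
  they come from the same source name.
\<close>

section \<open>Matching sequences\<close>

lemma match_map_Nil [simp]: "match_map \<sigma> [] = []"
  by (simp add: match_map_def)

lemma match_map_append [simp]: "match_map \<sigma> (M @ N) = match_map \<sigma> M @ match_map \<sigma> N"
  by (simp add: match_map_def)

lemma match_map_comp: "match_map \<sigma> (match_map \<rho> M) = match_map (\<sigma> \<circ> \<rho>) M"
  by (induction M) (auto simp: match_map_def)

lemma match_map_cong:
  "(\<And>x. x \<in> match_names M \<Longrightarrow> \<sigma> x = \<rho> x) \<Longrightarrow> match_map \<sigma> M = match_map \<rho> M"
  by (induction M) (auto simp: match_map_def match_names_def)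

lemma match_map_incl: "match_map \<sigma> (match_incl M) = match_map (\<sigma> \<circ> Name) M"
  by (induction M) (auto simp: match_map_def match_incl_def)

lemma match_map_add_match:
  "match_map \<sigma> (add_match x y M) = [] \<longleftrightarrow> \<sigma> x = \<sigma> y \<and> match_map \<sigma> M = []"
  by (auto simp: match_map_def add_match_def)

text \<open>A relabelling discards a proper match only by identifying its two names, which
  injectivity forbids. This is how a target match that has vanished yields an empty matching
  sequence in the source.\<close>

lemma match_map_inj_Nil:
  assumes "proper M" and "inj_on \<sigma> (match_names M)" and "match_map \<sigma> M = []"
  shows "M = []"
proof (rule ccontr)
  assume "M \<noteq> []"
  then obtain x y where xy: "(x, y) \<in> set M" by (cases M) auto
  with assms(3) have "\<sigma> x = \<sigma> y" by (auto simp: match_map_def filter_empty_conv)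
  moreover from xy have "x \<in> match_names M" "y \<in> match_names M"
    by (force simp: match_names_def)+
  ultimately have "x = y" using assms(2) by (auto dest: inj_onD)
  with xy assms(1) show False by (auto simp: proper_def)
qed

lemma match_map_id: "proper M \<Longrightarrow> match_map id M = M"
  by (induction M) (auto simp: match_map_def proper_def)

lemma proper_match_map [simp]: "proper (match_map \<sigma> M)"
  by (auto simp: proper_def match_map_def)

lemma proper_append [simp]: "proper (M @ N) \<longleftrightarrow> proper M \<and> proper N"
  by (auto simp: proper_def)

lemma proper_add_match: "proper M \<Longrightarrow> proper (add_match x y M)"
  by (auto simp: proper_def add_match_def)

lemma proper_match_incl: "proper M \<Longrightarrow> proper (match_incl M)"
  by (auto simp: proper_def match_incl_def)

lemma match_names_match_map: "match_names (match_map \<sigma> M) \<subseteq> \<sigma> ` match_names M"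
  by (force simp: match_names_def match_map_def)

section \<open>Free names and substitution\<close>

lemma finite_fnames [simp]: "finite (fnames P)"
  by (induction P) (auto simp: match_names_def)

lemma new_binder_fresh:
  assumes "infinite (UNIV :: 'n set)"
  shows "new_binder \<sigma> y (P :: ('n, 'k) proc) \<notin> \<sigma> ` (fnames P - {y})"
proof -
  have "\<exists>z. z \<notin> \<sigma> ` (fnames P - {y})"
    using assms by (intro ex_new_if_finite) auto
  then have "(SOME z. z \<notin> \<sigma> ` (fnames P - {y})) \<notin> \<sigma> ` (fnames P - {y})"
    by (rule someI_ex)
  then show ?thesis
    unfolding new_binder_def by presburger
qed

text \<open>Only an inclusion: a match made trivial by \<open>\<sigma>\<close> is dropped together
  with its names.\<close>

lemma fnames_subst: "fnames (subst P \<sigma>) \<subseteq> \<sigma> ` fnames P"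
proof (induction P arbitrary: \<sigma>)
  case (TauPre M P)
  then show ?case using match_names_match_map[of \<sigma> M] by fastforce
next
  case (OutPre M x y P)
  then show ?case using match_names_match_map[of \<sigma> M] by fastforce
next
  case (InPre M x y P)
  define z where "z = new_binder \<sigma> y P"
  have "fnames (subst P (\<sigma>(y := z))) - {z} \<subseteq> \<sigma> ` (fnames P - {y})"
    using InPre[of "\<sigma>(y := z)"] by (fastforce simp: image_iff split: if_splits)
  then show ?case
    using match_names_match_map[of \<sigma> M] by (auto simp: Let_def z_def[symmetric])
next
  case (Nu y P)
  define z where "z = new_binder \<sigma> y P"
  have "fnames (subst P (\<sigma>(y := z))) - {z} \<subseteq> \<sigma> ` (fnames P - {y})"
    using Nu[of "\<sigma>(y := z)"] by (fastforce simp: image_iff split: if_splits)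
  then show ?case
    by (auto simp: Let_def z_def[symmetric])
next
  case (Par P Q)
  then show ?case by fastforce
next
  case (Plus P Q)
  then show ?case by fastforce
qed auto

section \<open>Surjectivity of the relabellings\<close>

text \<open>The primes make tagging onto. A name with string starting with \<open>\<eta>\<close> is
  hit by removing this tag if it is unprimed, and is fixed if it is primed; every other private name
  is the image of itself with one more prime.\<close>

lemma tag_map_Priv_surj: "\<exists>\<rho>' k'. tag_map \<eta> (Priv \<rho>' k') = Priv \<rho> k"
proof (cases "\<rho> \<noteq> [] \<and> hd \<rho> = \<eta>")
  case True
  then obtain \<rho>' where \<rho>: "\<rho> = \<eta> # \<rho>'" by (cases \<rho>) auto
  show ?thesis
  proof (cases k)
    case 0
    with \<rho> have "tag_map \<eta> (Priv \<rho>' 0) = Priv \<rho> k" by simp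
    then show ?thesis by blast
  next
    case (Suc k')
    with \<rho> have "tag_map \<eta> (Priv \<rho> k) = Priv \<rho> k" by simp
    then show ?thesis by blast
  qed
next
  case False
  then have "tag_map \<eta> (Priv \<rho> (Suc k)) = Priv \<rho> k" by auto
  then show ?thesis by blast
qed

lemma surj_tag_map: "surj (tag_map \<eta>)"
  unfolding surj_def
proof
  fix u :: "'a name"
  show "\<exists>v. u = tag_map \<eta> v"
  proof (cases u)
    case (Priv \<rho> k)
    then show ?thesis by (metis tag_map_Priv_surj)
  qed (metis tag_map.simps)+
qed

text \<open>The name \<open>y\<close> is sent to \<open>p\<close> and recovered from
  \<open>p'\<close>. In turn \<open>p\<close>, which \<open>tag_map TagE\<close> reaches from
  \<open>p'\<close>, is now reached from \<open>y\<close>, so nothing is lost.\<close>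

lemma surj_priv_map: "surj (priv_map (Name y))"
  unfolding surj_def
proof
  fix u :: "'a name"
  show "\<exists>v. u = priv_map (Name y) v"
  proof (cases "u = Priv [] 0 \<or> u = Name y")
    case True
    moreover have "priv_map (Name y) (Name y) = Priv [] 0"
      and "priv_map (Name y) (Priv [] 1) = Name y"
      by (simp_all add: priv_map_def)
    ultimately show ?thesis by metis
  next
    case False
    obtain v where v: "u = tag_map TagE v"
      using surj_tag_map by (metis surjD)
    \<comment> \<open>Otherwise \<open>u\<close> would be \<open>Name y\<close>, which tagging
      fixes, or \<open>p\<close>, to which it sends \<open>p'\<close>.\<close>
    with False have "v \<noteq> Name y" "v \<noteq> Priv [] 1" by auto
    with v have "u = priv_map (Name y) v" by (simp add: priv_map_def)
    then show ?thesis ..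
  qed
qed

text \<open>The names in \<open>xs\<close> may disappear from the image when they are replaced; the
  first spare names bring them back, and the other spare names shift down to fill the gap.\<close>

lemma surj_spare_subst:
  assumes "length ys = length xs"
  shows "surj (spare_subst xs ys)"
  unfolding surj_def
proof
  fix u :: "'a name"
  show "\<exists>v. u = spare_subst xs ys v"
  proof (cases u)
    case (Name x)
    show ?thesis
    proof (cases "x \<in> set xs")
      case True
      then obtain i where "i < length xs" "x = xs ! i" by (metis in_set_conv_nth)
      with Name have "u = spare_subst xs ys (Spare i)" by simp
      then show ?thesis ..
    next
      case False
      with assms have "map_of (zip xs ys) x = None" by simp
      with Name have "u = spare_subst xs ys (Name x)" by simp
      then show ?thesis ..
    qed
  next
    case (Spare i)
    then have "u = spare_subst xs ys (Spare (i + length xs))" by simp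
    then show ?thesis ..
  next
    case (Priv \<rho> k)
    then have "u = spare_subst xs ys (Priv \<rho> k)" by simp
    then show ?thesis ..
  qed
qed

section \<open>The implementation relation\<close>

text \<open>The unprimed private names. They supply the fresh names, whereas the primed ones serve
  to make the relabellings onto.\<close>

definition pool :: "'n name set" where
  "pool = range (\<lambda>\<rho>. Priv \<rho> 0)"

text \<open>
  \<open>impl D S f \<tau> E P\<close>: below the relabelling \<open>f\<close>, the process \<open>E\<close> behaves as \<open>P\<close> does when each
  free name \<open>x\<close> of \<open>P\<close> is read as \<open>\<tau> x\<close>. The set \<open>S\<close> consists of the names owned by \<open>E\<close>: those
  that stand for a restriction of \<open>P\<close>, and those still available for restrictions yet to appear.
  Since only \<open>\<tau>\<close> sees the binders of \<open>P\<close>, the relation is insensitive to alpha-conversion of \<open>P\<close>,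
  and rule \<open>nu\<close> may be applied anywhere, so it is insensitive to the position of restrictions.
\<close>

inductive impl ::
  "('n, 'k) defs \<Rightarrow> 'n name set \<Rightarrow> ('n name \<Rightarrow> 'n name) \<Rightarrow> ('n \<Rightarrow> 'n name) \<Rightarrow> ('n, 'k) tccs
    \<Rightarrow> ('n, 'k) proc \<Rightarrow> bool"
  for D :: "('n, 'k) defs" where
  null: "impl D S f \<tau> empty_sum Null"
| tau: "\<lbrakk>proper M; proper M'; match_map f M = match_map \<tau> M'; impl D S f \<tau> E P\<rbrakk>
    \<Longrightarrow> impl D S f \<tau> (Prefix (ATau M) E) (TauPre M' P)"
| out: "\<lbrakk>proper M; proper M'; match_map f M = match_map \<tau> M'; f m = \<tau> x; f z = \<tau> y;
      impl D S f \<tau> E P\<rbrakk>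
    \<Longrightarrow> impl D S f \<tau> (Prefix (AOut M m z) E) (OutPre M' x y P)"
| inp: "\<lbrakk>proper M; proper M'; match_map f M = match_map \<tau> M'; f m = \<tau> x;
      \<And>z. impl D S f (\<tau>(y := f z)) (E z) P\<rbrakk>
    \<Longrightarrow> impl D S f \<tau> (name_sum (\<lambda>z. Prefix (AIn M m z) (E z))) (InPre M' x y P)"
| plus: "\<lbrakk>impl D S f \<tau> E P; impl D S f \<tau> F Q\<rbrakk> \<Longrightarrow> impl D S f \<tau> (binary_sum E F) (Plus P Q)"
| par: "\<lbrakk>impl D S1 f \<tau> E P; impl D S2 f \<tau> F Q; S1 \<inter> S2 = {}; S1 \<union> S2 \<subseteq> S\<rbrakk>
    \<Longrightarrow> impl D S f \<tau> (CPar E F) (Par P Q)"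
| nu: "\<lbrakk>u \<in> S; impl D (S - {u}) f (\<tau>(y := u)) E P\<rbrakk> \<Longrightarrow> impl D S f \<tau> E (Nu y P)"
| rel: "\<lbrakk>surj g; impl D S (f \<circ> g) \<tau> E P\<rbrakk> \<Longrightarrow> impl D S f \<tau> (Relabel E (act_map g)) P"
| call: "\<lbrakk>inj_on f pool; f ` pool \<subseteq> S; map (f \<circ> Name) (fst (D A)) = map \<tau> ys\<rbrakk>
    \<Longrightarrow> impl D S f \<tau> (Ident A) (Call A ys)"

section \<open>Change of reading and substitution\<close>

lemma impl_cong:
  "impl D S f \<tau> E P \<Longrightarrow> (\<And>x. x \<in> fnames P \<Longrightarrow> \<tau> x = \<tau>' x) \<Longrightarrow> impl D S f \<tau>' E P"
proof (induction arbitrary: \<tau>' rule: impl.induct)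
  case (tau M M' f \<tau> S E P)
  then have "match_map \<tau> M' = match_map \<tau>' M'" by (intro match_map_cong) auto
  with tau show ?case by (auto intro!: impl.tau)
next
  case (out M M' f \<tau> m x z y S E P)
  then have "match_map \<tau> M' = match_map \<tau>' M'" by (intro match_map_cong) auto
  with out show ?case by (auto intro!: impl.out)
next
  case (inp M M' f \<tau> m x S y E P)
  then have "match_map \<tau> M' = match_map \<tau>' M'" by (intro match_map_cong) auto
  with inp show ?case by (auto intro!: impl.inp)
next
  case (nu u S f \<tau> y E P)
  then show ?case by (intro impl.nu[of u]) auto
next
  case (par S1 f \<tau> E P S2 F Q S)
  then show ?case by (intro impl.par[of D S1 _ _ _ _ S2]) auto
next
  case (call f S A \<tau> ys)
  then have "map \<tau> ys = map \<tau>' ys" by auto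
  with call show ?case by (intro impl.call) auto
qed (auto intro: impl.intros)

text \<open>Substituting \<open>\<rho>\<close> and then reading by \<open>\<tau>\<close> amounts to
  reading by their composition. The target is untouched, since the names of the source process enter
  \<open>impl\<close> only through the reading.\<close>

lemma impl_subst:
  assumes inf: "infinite (UNIV :: 'n set)"
  shows "impl D S f \<tau>' E (P :: ('n, 'k) proc) \<Longrightarrow> (\<And>x. x \<in> fnames P \<Longrightarrow> \<tau>' x = \<tau> (\<rho> x))
    \<Longrightarrow> impl D S f \<tau> E (subst P \<rho>)"
proof (induction arbitrary: \<tau> \<rho> rule: impl.induct)
  case (tau M M' f \<tau>' S E P)
  then have "match_map \<tau>' M' = match_map \<tau> (match_map \<rho> M')"
    by (auto simp: match_map_comp intro!: match_map_cong)
  with tau show ?case by (auto intro!: impl.tau)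
next
  case (out M M' f \<tau>' m x z y S E P)
  then have "match_map \<tau>' M' = match_map \<tau> (match_map \<rho> M')"
    by (auto simp: match_map_comp intro!: match_map_cong)
  with out show ?case by (auto intro!: impl.out)
next
  case (inp M M' f \<tau>' m x S y E P)
  then have M: "match_map \<tau>' M' = match_map \<tau> (match_map \<rho> M')"
    by (auto simp: match_map_comp intro!: match_map_cong)
  define y' where "y' = new_binder \<rho> y P"
  \<comment> \<open>By the choice of \<open>y'\<close>, no free name of \<open>P\<close> other than
    \<open>y\<close> is sent to \<open>y'\<close>, so updating the reading at \<open>y'\<close>
    concerns the binder only.\<close>
  have "impl D S f (\<tau>(y' := f z)) (E z) (subst P (\<rho>(y := y')))" for z
    using new_binder_fresh[OF inf, of \<rho> y P] inp.prems
    by (intro inp.IH) (auto simp: y'_def[symmetric] image_iff)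
  with M inp show ?case by (auto simp: Let_def y'_def[symmetric] intro!: impl.inp)
next
  case (nu u S f \<tau>' y E P)
  define y' where "y' = new_binder \<rho> y P"
  have "impl D (S - {u}) f (\<tau>(y' := u)) E (subst P (\<rho>(y := y')))"
    using new_binder_fresh[OF inf, of \<rho> y P] nu.prems
    by (intro nu.IH) (auto simp: y'_def[symmetric] image_iff)
  with nu show ?case by (auto simp: Let_def y'_def[symmetric] intro: impl.nu)
next
  case (par S1 f \<tau>' E P S2 F Q S)
  then have "impl D S f \<tau> (CPar E F) (Par (subst P \<rho>) (subst Q \<rho>))"
    by (intro impl.par[of D S1 _ _ _ _ S2]) auto
  then show ?case by simp
next
  case (call f S A \<tau>' ys)
  then have "map \<tau>' ys = map \<tau> (map \<rho> ys)" by auto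
  with call show ?case by (auto intro: impl.call)
qed (auto intro: impl.intros)

lemma impl_subst1:
  assumes "infinite (UNIV :: 'n set)" and "impl D S f (\<tau>(y := \<tau> w)) E (P :: ('n, 'k) proc)"
  shows "impl D S f \<tau> E (subst1 P w y)"
  unfolding subst1_def using assms(2) by (rule impl_subst[OF assms(1)]) simp

text \<open>Covers the renaming of a binder by late input and by scope opening: \<open>w\<close> is
  free in \<open>P\<close> at most as \<open>y\<close> itself, so reading it as \<open>u\<close>
  disturbs no other free name.\<close>

lemma impl_subst1_fresh:
  assumes inf: "infinite (UNIV :: 'n set)" and "impl D S f (\<tau>(y := u)) E (P :: ('n, 'k) proc)"
    and "w \<notin> fnames (Nu y P)"
  shows "impl D S f (\<tau>(w := u)) E (subst1 P w y)"
proof (rule impl_subst1[OF inf])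
  show "impl D S f (\<tau>(w := u, y := (\<tau>(w := u)) w)) E P"
    using assms(2) by (rule impl_cong) (use assms(3) in auto)
qed

text \<open>The induction generalises over the surrounding relabelling \<open>f\<close>: going below
  a relabelling of the translation composes it with \<open>f\<close>, and each of these relabellings
  is injective on \<open>pool\<close> and maps it into itself.\<close>

lemma impl_transl:
  assumes wf: "wf_defs D"
  shows "\<lbrakk>wf_proc D P; inj_on f pool; f ` pool \<subseteq> S\<rbrakk>
    \<Longrightarrow> impl D S f (f \<circ> Name) (transl D P) P"
proof (induction P arbitrary: f S)
  case Null
  show ?case by (auto intro: impl.null)
next
  case (TauPre M P)
  then show ?case
    by (auto simp: match_map_incl comp_def intro!: impl.tau proper_match_incl)
next
  case (OutPre M x y P)
  then show ?case
    by (auto simp: match_map_incl comp_def intro!: impl.out proper_match_incl)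
next
  case (InPre M x y P)
  have "impl D S f ((f \<circ> Name)(y := f z)) (Relabel (transl D P) (act_map (spare_subst [y] [z]))) P"
    for z
  proof (rule impl.rel)
    show "surj (spare_subst [y] [z])" by (simp add: surj_spare_subst)
    \<comment> \<open>Private names are untouched, so the supply of fresh names stays the same; of
      the reading, only the value at \<open>y\<close> changes.\<close>
    have eq: "spare_subst [y] [z] u = u" if "u \<in> pool" for u
      using that by (auto simp: pool_def)
    have "inj_on (f \<circ> spare_subst [y] [z]) pool" "(f \<circ> spare_subst [y] [z]) ` pool \<subseteq> S"
      using InPre.prems by (auto simp: inj_on_def eq)
    then have "impl D S (f \<circ> spare_subst [y] [z]) (f \<circ> spare_subst [y] [z] \<circ> Name) (transl D P) P"
      using InPre.prems(1) by (intro InPre.IH) (simp only: wf_proc.simps)+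
    moreover have "f \<circ> spare_subst [y] [z] \<circ> Name = (f \<circ> Name)(y := f z)" by auto
    ultimately show "impl D S (f \<circ> spare_subst [y] [z]) ((f \<circ> Name)(y := f z)) (transl D P) P"
      by simp
  qed
  with InPre.prems show ?case
    by (auto simp: match_map_incl comp_def intro!: impl.inp proper_match_incl)
next
  case (Nu y P)
  let ?p = "priv_map (Name y)" and ?u = "f (Priv [] 0)"
  \<comment> \<open>The unprimed private names below the restriction all receive the tag
    \<open>TagE\<close>. This leaves \<open>p\<close> itself free to stand for \<open>y\<close>, and
    its image \<open>?u\<close> is withdrawn from the owned names.\<close>
  have p: "?p (Priv \<rho> 0) = Priv (TagE # \<rho>) 0" for \<rho>
    by (simp add: priv_map_def)
  have inj: "f (Priv \<rho> 0) = f (Priv \<rho>' 0) \<longleftrightarrow> \<rho> = \<rho>'" for \<rho> \<rho>'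
    using Nu.prems(2) by (auto simp: inj_on_def pool_def)
  have "inj_on (f \<circ> ?p) pool"
    by (auto simp: inj_on_def pool_def p inj)
  moreover have "(f \<circ> ?p) ` pool \<subseteq> S - {?u}"
    using Nu.prems(3) by (auto simp: pool_def p inj)
  ultimately have "impl D (S - {?u}) (f \<circ> ?p) (f \<circ> ?p \<circ> Name) (transl D P) P"
    using Nu.prems(1) by (intro Nu.IH) (simp only: wf_proc.simps)+
  moreover have "f \<circ> ?p \<circ> Name = (f \<circ> Name)(y := ?u)"
    by (auto simp: priv_map_def)
  ultimately have "impl D (S - {?u}) f ((f \<circ> Name)(y := ?u)) (transl D (Nu y P)) P"
    by (simp only: transl.simps impl.rel surj_priv_map)
  moreover have "?u \<in> S"
    using Nu.prems(3) by (auto simp: pool_def)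
  ultimately show ?case by (rule impl.nu[rotated])
next
  case (Par P Q)
  have inj: "inj_on (f \<circ> tag_map \<eta>) pool" for \<eta>
    using Par.prems(2) by (force simp: inj_on_def pool_def)
  have eq: "f \<circ> tag_map \<eta> \<circ> Name = f \<circ> Name" for \<eta>
    by auto
  have "impl D ((f \<circ> tag_map TagL) ` pool) f (f \<circ> Name) (Relabel (transl D P) (act_map (tag_map TagL))) P"
    using Par.IH(1)[OF _ inj order_refl, of TagL] Par.prems(1)
    by (simp only: eq impl.rel surj_tag_map wf_proc.simps)
  moreover have "impl D ((f \<circ> tag_map TagR) ` pool) f (f \<circ> Name) (Relabel (transl D Q) (act_map (tag_map TagR))) Q"
    using Par.IH(2)[OF _ inj order_refl, of TagR] Par.prems(1)
    by (simp only: eq impl.rel surj_tag_map wf_proc.simps)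
  \<comment> \<open>The two halves carry different leading tags, and \<open>f\<close> is injective
    on \<open>pool\<close>.\<close>
  moreover have "(f \<circ> tag_map TagL) ` pool \<inter> (f \<circ> tag_map TagR) ` pool = {}"
    using Par.prems(2) by (force simp: inj_on_def pool_def)
  moreover have "(f \<circ> tag_map TagL) ` pool \<union> (f \<circ> tag_map TagR) ` pool \<subseteq> S"
    using Par.prems(3) by (force simp: pool_def)
  ultimately show ?case
    unfolding transl.simps by (rule impl.par)
next
  case (Plus P Q)
  then show ?case by (auto intro: impl.plus)
next
  case (Call A ys)
  let ?xs = "fst (D A)" and ?g = "spare_subst (fst (D A)) (map Name ys)"
  have len: "length ys = length ?xs" and dist: "distinct ?xs"
    using Call.prems(1) wf by (auto simp: wf_defs_def)
  have eq: "?g u = u" if "u \<in> pool" for u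
    using that by (auto simp: pool_def)
  have "map (f \<circ> ?g \<circ> Name) ?xs = map (f \<circ> Name) ys"
  proof (rule nth_equalityI)
    fix i assume "i < length (map (f \<circ> ?g \<circ> Name) ?xs)"
    with len dist show "map (f \<circ> ?g \<circ> Name) ?xs ! i = map (f \<circ> Name) ys ! i"
      using map_of_zip_nth[of ?xs "map Name ys" i] by simp
  qed (simp add: len)
  moreover have "inj_on (f \<circ> ?g) pool" "(f \<circ> ?g) ` pool \<subseteq> S"
    using Call.prems by (auto simp: inj_on_def eq)
  ultimately have "impl D S (f \<circ> ?g) (f \<circ> Name) (Ident A) (Call A ys)"
    by (intro impl.call) auto
  moreover have "surj ?g"
    using len by (simp add: surj_spare_subst)
  ultimately show ?case
    unfolding transl.simps by (rule impl.rel[rotated])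
qed

text \<open>Lets a condition on the free names of a call pass to the unfolded body.\<close>

lemma fnames_subst_list:
  assumes "wf_defs D" and "D A = (xs, P)" and "length ys = length xs"
  shows "fnames (subst_list P xs ys) \<subseteq> set ys"
proof -
  let ?\<rho> = "\<lambda>x. case map_of (zip xs ys) x of Some y \<Rightarrow> y | None \<Rightarrow> x"
  have P: "fnames P \<subseteq> set xs"
    using assms by (metis wf_defs_def fst_conv snd_conv)
  have "?\<rho> x \<in> set ys" if x: "x \<in> set xs" for x
  proof -
    obtain y where "map_of (zip xs ys) x = Some y"
      using x assms(3) by (metis map_of_zip_is_Some)
    then show ?thesis
      by (auto dest!: map_of_SomeD simp: set_zip)
  qed
  with P fnames_subst[of P ?\<rho>] show ?thesis
    unfolding subst_list_def by blast
qed

text \<open>The target body reads the formal parameters by \<open>f\<close> after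
  \<open>Name\<close>, which by assumption gives the values of the actual ones. All free names of
  the body are formal parameters, so \<open>impl_subst\<close> moves this change of reading into the
  source process.\<close>

lemma impl_unfold:
  assumes inf: "infinite (UNIV :: 'n set)" and wf: "wf_defs (D :: ('n, 'k) defs)"
    and A: "D A = (xs, P)"
    and f: "inj_on f pool" "f ` pool \<subseteq> S" and ys: "map (f \<circ> Name) xs = map \<tau> ys"
  shows "impl D S f \<tau> (transl_defs D A) (subst_list P xs ys)"
  unfolding subst_list_def
proof (rule impl_subst[OF inf])
  have P: "fnames P \<subseteq> set xs" and wfP: "wf_proc D P" and dist: "distinct xs"
    using wf A by (metis wf_defs_def fst_conv snd_conv)+
  show "impl D S f (f \<circ> Name) (transl_defs D A) P"
    using impl_transl[OF wf wfP f] A by (simp add: transl_defs_def)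
  fix x assume "x \<in> fnames P"
  with P obtain i where i: "i < length xs" "x = xs ! i"
    by (metis in_set_conv_nth subsetD)
  have len: "length ys = length xs" using ys by (metis length_map)
  have "(f \<circ> Name) (xs ! i) = \<tau> (ys ! i)" using ys i len by (metis nth_map)
  with i len dist show "(f \<circ> Name) x =
      \<tau> (case map_of (zip xs ys) x of Some y \<Rightarrow> y | None \<Rightarrow> x)"
    by (simp add: map_of_zip_nth)
qed

section \<open>Transitions of the implemented process\<close>

abbreviation cstep :: "('n, 'k) defs \<Rightarrow> ('n, 'k) tccs \<Rightarrow> 'n name action \<Rightarrow> ('n, 'k) tccs \<Rightarrow> bool"
  where "cstep D \<equiv> ccs_trans gam (transl_defs D)"

text \<open>The matching sequence must vanish only after \<open>f\<close>, as outer relabellings may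
  still identify names; properness then makes it empty at the outermost level, where
  \<open>f\<close> is \<open>id\<close>. A bound output gives up the owned name it emits, and
  \<open>w\<close> is read as that name from then on.\<close>

primrec simulated ::
  "('n, 'k) defs \<Rightarrow> 'n name set \<Rightarrow> ('n name \<Rightarrow> 'n name) \<Rightarrow> ('n \<Rightarrow> 'n name) \<Rightarrow> ('n, 'k) tccs
    \<Rightarrow> ('n, 'k) proc \<Rightarrow> 'n label \<Rightarrow> bool" where
  "simulated D S f \<tau> E P' LTau \<longleftrightarrow>
     (\<exists>M E'. cstep D E (ATau M) E' \<and> proper M \<and> match_map f M = [] \<and> impl D S f \<tau> E' P')"
| "simulated D S f \<tau> E P' (LOut x y) \<longleftrightarrow>
     (\<exists>M m z E'. cstep D E (AOut M m z) E' \<and> proper M \<and> match_map f M = [] \<and>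
        f m = \<tau> x \<and> f z = \<tau> y \<and> impl D S f \<tau> E' P')"
| "simulated D S f \<tau> E P' (LBOut x w) \<longleftrightarrow>
     (\<exists>M m z E'. cstep D E (AOut M m z) E' \<and> proper M \<and> match_map f M = [] \<and>
        f m = \<tau> x \<and> f z \<in> S \<and> impl D (S - {f z}) f (\<tau>(w := f z)) E' P')"
| "simulated D S f \<tau> E P' (LIn x w) \<longleftrightarrow>
     (\<forall>z. \<exists>M m E'. cstep D E (AIn M m z) E' \<and> proper M \<and> match_map f M = [] \<and>
        f m = \<tau> x \<and> impl D S f (\<tau>(w := f z)) E' P')"

text \<open>
  Surjectivity is needed here: an input must accept every name \<open>z\<close> proposed by the environment,
  and the two partners of a communication must agree on the object before relabelling by \<open>f\<close>.
\<close>

lemma simulated_Relabel: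
  assumes g: "surj g" and sim: "simulated D S (f \<circ> g) \<tau> E P' \<alpha>"
  shows "simulated D S f \<tau> (Relabel E (act_map g)) P' \<alpha>"
proof (cases \<alpha>)
  case LTau
  then obtain M E' where E': "cstep D E (ATau M) E'" "match_map (f \<circ> g) M = []"
    "impl D S (f \<circ> g) \<tau> E' P'"
    using sim by auto
  from ccs_trans.relabel[OF E'(1), of "act_map g"] impl.rel[OF g E'(3)] E'(2)
  show ?thesis
    unfolding LTau simulated.simps act_map.simps by (metis match_map_comp proper_match_map)
next
  case (LOut x y)
  then obtain M m z E' where E': "cstep D E (AOut M m z) E'" "match_map (f \<circ> g) M = []"
    "f (g m) = \<tau> x" "f (g z) = \<tau> y" "impl D S (f \<circ> g) \<tau> E' P'"
    using sim by auto
  from ccs_trans.relabel[OF E'(1), of "act_map g"] impl.rel[OF g E'(5)] E'(2-4)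
  show ?thesis
    unfolding LOut simulated.simps act_map.simps by (metis match_map_comp proper_match_map)
next
  case (LBOut x w)
  then obtain M m z E' where E': "cstep D E (AOut M m z) E'" "match_map (f \<circ> g) M = []"
    "f (g m) = \<tau> x" "f (g z) \<in> S" "impl D (S - {f (g z)}) (f \<circ> g) (\<tau>(w := f (g z))) E' P'"
    using sim by auto
  from ccs_trans.relabel[OF E'(1), of "act_map g"] impl.rel[OF g E'(5)] E'(2-4)
  show ?thesis
    unfolding LBOut simulated.simps act_map.simps by (metis match_map_comp proper_match_map)
next
  case (LIn x w)
  have "\<exists>M m E'. cstep D (Relabel E (act_map g)) (AIn M m z) E' \<and> proper M \<and>
      match_map f M = [] \<and> f m = \<tau> x \<and> impl D S f (\<tau>(w := f z)) E' P'" for z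
  proof -
    obtain z0 where z: "z = g z0" using g by (metis surjD)
    obtain M m E' where E': "cstep D E (AIn M m z0) E'" "match_map (f \<circ> g) M = []"
      "f (g m) = \<tau> x" "impl D S (f \<circ> g) (\<tau>(w := f (g z0))) E' P'"
      using sim LIn by fastforce
    from ccs_trans.relabel[OF E'(1), of "act_map g"] impl.rel[OF g E'(4)] E'(2,3)
    show ?thesis
      unfolding z act_map.simps by (metis match_map_comp proper_match_map)
  qed
  with LIn show ?thesis by simp
qed

section \<open>Simulation in parallel, communication and restriction contexts\<close>

lemma simulated_mono:
  assumes "simulated D S f \<tau> E P' \<alpha>" and "\<And>a E'. cstep D E a E' \<Longrightarrow> cstep D F a E'"
  shows "simulated D S f \<tau> F P' \<alpha>"
  using assms by (cases \<alpha>) (simp only: simulated.simps, blast)+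

text \<open>The active component gives up the names in \<open>T\<close> and changes the reading, but
  only off the free names of its idle partner, which therefore remains related.\<close>

lemma impl_par_upd:
  assumes P: "impl D (S1 - T) f \<tau>' E P" and "impl D S2 f \<tau> F Q" and T: "T \<subseteq> S1"
    and S: "S1 \<inter> S2 = {}" "S1 \<union> S2 \<subseteq> S" and eq: "\<forall>x\<in>fnames Q. \<tau>' x = \<tau> x"
  shows "impl D (S - T) f \<tau>' (CPar E F) (Par P Q)"
    and "impl D (S - T) f \<tau>' (CPar F E) (Par Q P)"
proof -
  have Q: "impl D S2 f \<tau>' F Q"
    using assms(2) by (rule impl_cong) (use eq in auto)
  show "impl D (S - T) f \<tau>' (CPar E F) (Par P Q)"
    by (rule impl.par[OF P Q]) (use T S in auto)
  show "impl D (S - T) f \<tau>' (CPar F E) (Par Q P)"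
    by (rule impl.par[OF Q P]) (use T S in auto)
qed

text \<open>Treats all labels uniformly: \<open>T\<close> is the singleton of the extruded name for
  a bound output and empty otherwise, and \<open>\<tau>'\<close> may differ from
  \<open>\<tau>\<close> at the bound name of the label.\<close>

lemma simulated_context:
  assumes sim: "simulated D S1 f \<tau> E P' \<alpha>" and "S1 \<subseteq> S"
    and step: "\<And>a E'. cstep D E a E' \<Longrightarrow> cstep D G a (K E')"
    and impl: "\<And>T \<tau>' E'. \<lbrakk>impl D (S1 - T) f \<tau>' E' P'; T \<subseteq> S1; \<forall>x. x \<notin> bn \<alpha> \<longrightarrow> \<tau>' x = \<tau> x\<rbrakk>
      \<Longrightarrow> impl D (S - T) f \<tau>' (K E') R'"
  shows "simulated D S f \<tau> G R' \<alpha>"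
proof (cases \<alpha>)
  case LTau
  with sim impl[of "{}" \<tau>] show ?thesis
    by (auto intro: step)
next
  case (LOut x y)
  have "impl D S f \<tau> (K E') R'" if "impl D S1 f \<tau> E' P'" for E'
    using impl[of "{}" \<tau> E'] that by simp
  with sim show ?thesis
    unfolding LOut simulated.simps by (blast intro: step)
next
  case (LBOut x w)
  have "impl D (S - {u}) f (\<tau>(w := u)) (K E') R'"
    if "impl D (S1 - {u}) f (\<tau>(w := u)) E' P'" "u \<in> S1" for E' u
    using impl[of "{u}" "\<tau>(w := u)" E'] that LBOut by simp
  with sim \<open>S1 \<subseteq> S\<close> show ?thesis
    unfolding LBOut simulated.simps by (blast intro: step)
next
  case (LIn x w)
  have "impl D S f (\<tau>(w := u)) (K E') R'" if "impl D S1 f (\<tau>(w := u)) E' P'" for E' u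
    using impl[of "{}" "\<tau>(w := u)" E'] that LIn by simp
  with sim show ?thesis
    unfolding LIn simulated.simps by (blast intro: step)
qed

lemma simulated_par1:
  assumes "simulated D S1 f \<tau> E P' \<alpha>" and "impl D S2 f \<tau> F Q"
    and "S1 \<inter> S2 = {}" "S1 \<union> S2 \<subseteq> S" and "bn \<alpha> \<inter> fnames Q = {}"
  shows "simulated D S f \<tau> (CPar E F) (Par P' Q) \<alpha>"
  using assms(1)
proof (rule simulated_context[where K = "\<lambda>E'. CPar E' F"])
  fix T \<tau>' E' assume "impl D (S1 - T) f \<tau>' E' P'" "T \<subseteq> S1" "\<forall>x. x \<notin> bn \<alpha> \<longrightarrow> \<tau>' x = \<tau> x"
  with assms show "impl D (S - T) f \<tau>' (CPar E' F) (Par P' Q)"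
    by (intro impl_par_upd(1)[of D S1 _ _ _ _ _ S2 \<tau>]) auto
qed (use assms in \<open>auto intro: ccs_trans.left\<close>)

lemma simulated_par2:
  assumes "simulated D S2 f \<tau> F Q' \<alpha>" and "impl D S1 f \<tau> E P"
    and "S1 \<inter> S2 = {}" "S1 \<union> S2 \<subseteq> S" and "bn \<alpha> \<inter> fnames P = {}"
  shows "simulated D S f \<tau> (CPar E F) (Par P Q') \<alpha>"
  using assms(1)
proof (rule simulated_context[where K = "CPar E"])
  fix T \<tau>' F' assume "impl D (S2 - T) f \<tau>' F' Q'" "T \<subseteq> S2" "\<forall>x. x \<notin> bn \<alpha> \<longrightarrow> \<tau>' x = \<tau> x"
  with assms show "impl D (S - T) f \<tau>' (CPar E F') (Par P Q')"
    by (intro impl_par_upd(2)[of D S2 _ _ _ _ _ S1 \<tau>]) auto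
qed (use assms in \<open>auto intro: ccs_trans.right\<close>)

lemma impl_par_receive:
  assumes "infinite (UNIV :: 'n set)"
    and "impl D S1 f \<tau> E (P :: ('n, 'k) proc)" and "impl D S2 f (\<tau>(w := \<tau> y)) F Q"
    and "S1 \<inter> S2 = {}" and "S1 \<union> S2 \<subseteq> S"
  shows "impl D S f \<tau> (CPar E F) (Par P (subst1 Q y w))"
    and "impl D S f \<tau> (CPar F E) (Par (subst1 Q y w) P)"
  using assms impl_subst1[OF assms(1,3)] by (auto intro: impl.par)

text \<open>The target gains no operator: rule \<open>nu\<close> takes the name \<open>u\<close>
  given up by the sender and lets it back the new source restriction around the composition.\<close>

lemma impl_par_close:
  assumes "impl D (S1 - {u}) f (\<tau>(w := u)) E P" and "impl D S2 f (\<tau>(w := u)) F Q"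
    and "u \<in> S1" and "S1 \<inter> S2 = {}" and "S1 \<union> S2 \<subseteq> S"
  shows "impl D S f \<tau> (CPar E F) (Nu w (Par P Q))"
    and "impl D S f \<tau> (CPar F E) (Nu w (Par Q P))"
  by (rule impl.nu[of u], use assms in \<open>auto intro: impl.par\<close>)+

text \<open>The label does not mention \<open>y\<close>, so its names are read as outside the
  restriction, and rule \<open>nu\<close> can be reapplied to the derivative.\<close>

lemma simulated_res:
  assumes "u \<in> S" and "simulated D (S - {u}) f (\<tau>(y := u)) E P' \<alpha>" and "y \<notin> label_names \<alpha>"
  shows "simulated D S f \<tau> E (Nu y P') \<alpha>"
proof (cases \<alpha>)
  case LTau
  with assms show ?thesis by (auto intro: impl.nu)
next
  case (LOut x z)
  with assms show ?thesis by simp (metis impl.nu)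
next
  case (LBOut x w)
  with assms obtain M m z E' where E': "cstep D E (AOut M m z) E'" "proper M" "match_map f M = []"
    "f m = \<tau> x" "f z \<in> S - {u}" "impl D (S - {u} - {f z}) f (\<tau>(y := u, w := f z)) E' P'"
    by auto
  \<comment> \<open>The binders \<open>y\<close> and \<open>w\<close> differ, so the two updates of
    the reading commute.\<close>
  have "impl D (S - {f z} - {u}) f (\<tau>(w := f z, y := u)) E' P'"
    using E'(6) assms(3) LBOut by (simp add: fun_upd_twist[of y w] Diff_insert2[symmetric] insert_commute)
  then have "impl D (S - {f z}) f (\<tau>(w := f z)) E' (Nu y P')"
    using assms(1) E'(5) by (auto intro: impl.nu)
  with E' LBOut show ?thesis by auto
next
  case (LIn x w)
  with assms have "\<tau>(y := u, w := v) = \<tau>(w := v, y := u)" for v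
    by (auto simp: fun_upd_twist)
  with assms LIn show ?thesis by simp (metis impl.nu)
qed

lemma simulated_LTau_comm:
  assumes "cstep D E (ATau (add_match m n (M @ N))) E'" and "impl D S f \<tau> E' P'"
    and "proper M" "proper N" "match_map f M = []" "match_map f N = []" "f m = f n"
  shows "simulated D S f \<tau> E P' LTau"
  unfolding simulated.simps
  using assms by (intro exI[of _ "add_match m n (M @ N)"] exI[of _ E'])
    (simp add: match_map_add_match proper_add_match)

text \<open>Rule induction on the source transition, with an inner induction on \<open>impl\<close>.
  The shape of the source process leaves only its structural rule and \<open>rel\<close>, and
  \<open>rel\<close> is always settled by \<open>simulated_Relabel\<close>.\<close>

lemma impl_simulates:
  assumes inf: "infinite (UNIV :: 'n set)" and wf: "wf_defs (D :: ('n, 'k) defs)"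
  shows "pi_trans D P \<alpha> P' \<Longrightarrow> impl D S f \<tau> E P \<Longrightarrow> simulated D S f \<tau> E P' \<alpha>"
proof (induction arbitrary: S f \<tau> E rule: pi_trans.induct)
  case (tau P)
  from tau.prems show ?case
  proof (induction S f \<tau> E "TauPre [] P" rule: impl.induct)
    case (tau M f \<tau> S E)
    then show ?case by (auto intro: ccs_trans.prefix)
  qed (rule simulated_Relabel)
next
  case (out x y P)
  from out.prems show ?case
  proof (induction S f \<tau> E "OutPre [] x y P" rule: impl.induct)
    case (out M f \<tau> m z S E)
    then show ?case by simp (metis ccs_trans.prefix)
  qed (rule simulated_Relabel)
next
  case (inp w y P x)
  note w = inp.hyps
  from inp.prems show ?case
  proof (induction S f \<tau> E "InPre [] x y P" rule: impl.induct)
    case (inp M f \<tau> m S E)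
    have "impl D S f (\<tau>(w := f z)) (E z) (subst1 P w y)" for z
      using inp.hyps(5) w by (rule impl_subst1_fresh[OF inf])
    moreover have "cstep D (name_sum (\<lambda>z. Prefix (AIn M m z) (E z))) (AIn M m z) (E z)" for z
      unfolding name_sum_def by (rule ccs_trans.sum[of _ "Inl z"]) (auto intro: ccs_trans.prefix)
    ultimately show ?case using inp.hyps(1,3,4) unfolding simulated.simps match_map_Nil by blast
  qed (rule simulated_Relabel)
next
  case (sum1 P \<alpha> P' Q)
  note IH = sum1.IH
  from sum1.prems show ?case
  proof (induction S f \<tau> E "Plus P Q" rule: impl.induct)
    case (plus S f \<tau> E F)
    from IH[OF plus.hyps(1)] show ?case
      by (rule simulated_mono)
        (auto simp: binary_sum_def intro: ccs_trans.sum[of _ "Inr True"])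
  qed (rule simulated_Relabel)
next
  case (sum2 Q \<alpha> Q' P)
  note IH = sum2.IH
  from sum2.prems show ?case
  proof (induction S f \<tau> E "Plus P Q" rule: impl.induct)
    case (plus S f \<tau> E F)
    from IH[OF plus.hyps(3)] show ?case
      by (rule simulated_mono)
        (auto simp: binary_sum_def intro: ccs_trans.sum[of _ "Inr False"])
  qed (rule simulated_Relabel)
next
  case (ide A xs P ys \<alpha> P')
  note IH = ide.IH and A = ide.hyps(1)
  from ide.prems show ?case
  proof (induction S f \<tau> E "Call A ys" rule: impl.induct)
    case (call f S \<tau>)
    with A have "impl D S f \<tau> (transl_defs D A) (subst_list P xs ys)"
      by (auto intro: impl_unfold[OF inf wf])
    from IH[OF this] show ?case
      by (rule simulated_mono) (rule ccs_trans.ident)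
  qed (rule simulated_Relabel)
next
  case (par1 P \<alpha> P' Q)
  note IH = par1.IH and bn = par1.hyps(2)
  from par1.prems show ?case
  proof (induction S f \<tau> E "Par P Q" rule: impl.induct)
    case (par S1 f \<tau> E S2 F S)
    from simulated_par1[OF IH[OF par.hyps(1)] par.hyps(3,5,6) bn] show ?case .
  qed (rule simulated_Relabel)
next
  case (par2 Q \<alpha> Q' P)
  note IH = par2.IH and bn = par2.hyps(2)
  from par2.prems show ?case
  proof (induction S f \<tau> E "Par P Q" rule: impl.induct)
    case (par S1 f \<tau> E S2 F S)
    from simulated_par2[OF IH[OF par.hyps(3)] par.hyps(1,5,6) bn] show ?case .
  qed (rule simulated_Relabel)
next
  case (com1 P x y P' Q w Q')
  note IH = com1.IH
  from com1.prems show ?case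
  proof (induction S f \<tau> E "Par P Q" rule: impl.induct)
    case (par S1 f \<tau> E S2 F S)
    from IH(1)[OF par.hyps(1)] obtain M m z E' where E': "cstep D E (AOut M m z) E'" "proper M"
      "match_map f M = []" "f m = \<tau> x" "f z = \<tau> y" "impl D S1 f \<tau> E' P'"
      by auto
    \<comment> \<open>The input is asked for the very \<open>z\<close> that the output emits,
      because \<open>gam\<close> compares objects before \<open>f\<close> is applied.\<close>
    from IH(2)[OF par.hyps(3)] obtain N n F' where F': "cstep D F (AIn N n z) F'" "proper N"
      "match_map f N = []" "f n = \<tau> x" "impl D S2 f (\<tau>(w := f z)) F' Q'"
      by fastforce
    have "cstep D (CPar E F) (ATau (add_match m n (M @ N))) (CPar E' F')"
      using E'(1) F'(1) by (rule ccs_trans.comm) simp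
    moreover have "impl D S f \<tau> (CPar E' F') (Par P' (subst1 Q' y w))"
      using impl_par_receive(1)[OF inf E'(6)] F'(5) E'(5) par.hyps(5,6) by simp
    ultimately show ?case
      by (rule simulated_LTau_comm) (use E'(2-4) F'(2-4) in auto)
  qed (rule simulated_Relabel)
next
  case (com2 P x w P' Q y Q')
  note IH = com2.IH
  from com2.prems show ?case
  proof (induction S f \<tau> E "Par P Q" rule: impl.induct)
    case (par S1 f \<tau> E S2 F S)
    from IH(2)[OF par.hyps(3)] obtain M m z F' where F': "cstep D F (AOut M m z) F'" "proper M"
      "match_map f M = []" "f m = \<tau> x" "f z = \<tau> y" "impl D S2 f \<tau> F' Q'"
      by auto
    from IH(1)[OF par.hyps(1)] obtain N n E' where E': "cstep D E (AIn N n z) E'" "proper N"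
      "match_map f N = []" "f n = \<tau> x" "impl D S1 f (\<tau>(w := f z)) E' P'"
      by fastforce
    have "cstep D (CPar E F) (ATau (add_match m n (M @ N))) (CPar E' F')"
      using E'(1) F'(1) by (rule ccs_trans.comm) simp
    moreover have "impl D S f \<tau> (CPar E' F') (Par (subst1 P' y w) Q')"
      using impl_par_receive(2)[OF inf F'(6)] E'(5) F'(5) par.hyps(5,6) by (simp add: ac_simps)
    ultimately show ?case
      by (rule simulated_LTau_comm) (use E'(2-4) F'(2-4) in auto)
  qed (rule simulated_Relabel)
next
  case (close1 P x w P' Q Q')
  note IH = close1.IH
  from close1.prems show ?case
  proof (induction S f \<tau> E "Par P Q" rule: impl.induct)
    case (par S1 f \<tau> E S2 F S)
    from IH(1)[OF par.hyps(1)] obtain M m z E' where E': "cstep D E (AOut M m z) E'" "proper M"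
      "match_map f M = []" "f m = \<tau> x" "f z \<in> S1" "impl D (S1 - {f z}) f (\<tau>(w := f z)) E' P'"
      by auto
    from IH(2)[OF par.hyps(3)] obtain N n F' where F': "cstep D F (AIn N n z) F'" "proper N"
      "match_map f N = []" "f n = \<tau> x" "impl D S2 f (\<tau>(w := f z)) F' Q'"
      by fastforce
    have "cstep D (CPar E F) (ATau (add_match m n (M @ N))) (CPar E' F')"
      using E'(1) F'(1) by (rule ccs_trans.comm) simp
    moreover have "impl D S f \<tau> (CPar E' F') (Nu w (Par P' Q'))"
      using impl_par_close(1)[OF E'(6) F'(5) E'(5)] par.hyps(5,6) by simp
    ultimately show ?case
      by (rule simulated_LTau_comm) (use E'(2-4) F'(2-4) in auto)
  qed (rule simulated_Relabel)
next
  case (close2 P x w P' Q Q')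
  note IH = close2.IH
  from close2.prems show ?case
  proof (induction S f \<tau> E "Par P Q" rule: impl.induct)
    case (par S1 f \<tau> E S2 F S)
    from IH(2)[OF par.hyps(3)] obtain M m z F' where F': "cstep D F (AOut M m z) F'" "proper M"
      "match_map f M = []" "f m = \<tau> x" "f z \<in> S2" "impl D (S2 - {f z}) f (\<tau>(w := f z)) F' Q'"
      by auto
    from IH(1)[OF par.hyps(1)] obtain N n E' where E': "cstep D E (AIn N n z) E'" "proper N"
      "match_map f N = []" "f n = \<tau> x" "impl D S1 f (\<tau>(w := f z)) E' P'"
      by fastforce
    have "cstep D (CPar E F) (ATau (add_match m n (M @ N))) (CPar E' F')"
      using E'(1) F'(1) by (rule ccs_trans.comm) simp
    moreover have "impl D S f \<tau> (CPar E' F') (Nu w (Par P' Q'))"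
      using impl_par_close(2)[OF F'(6) E'(5) F'(5)] par.hyps(5,6) by (simp add: ac_simps)
    ultimately show ?case
      by (rule simulated_LTau_comm) (use E'(2-4) F'(2-4) in auto)
  qed (rule simulated_Relabel)
next
  case (res P \<alpha> P' y)
  note IH = res.IH and y = res.hyps(2)
  from res.prems show ?case
  proof (induction S f \<tau> E "Nu y P" rule: impl.induct)
    case (nu u S f \<tau> E)
    from simulated_res[OF nu.hyps(1) IH[OF nu.hyps(2)] y] show ?case .
  qed (rule simulated_Relabel)
next
  case (opn P x y P' w)
  note IH = opn.IH and y = opn.hyps(2) and w = opn.hyps(3)
  from opn.prems show ?case
  proof (induction S f \<tau> E "Nu y P" rule: impl.induct)
    case (nu u S f \<tau> E)
    \<comment> \<open>A free output of \<open>y\<close> inside the restriction emits a name read as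
      \<open>u\<close>, which is owned outside: exactly what a bound output requires.\<close>
    from IH[OF nu.hyps(2)] y obtain M m z E' where E': "cstep D E (AOut M m z) E'" "proper M"
      "match_map f M = []" "f m = \<tau> x" "f z = u" "impl D (S - {u}) f (\<tau>(y := u)) E' P'"
      unfolding simulated.simps by (metis fun_upd_apply)
    from impl_subst1_fresh[OF inf E'(6) w] E' nu.hyps(1) show ?case by auto
  qed (rule simulated_Relabel)
qed

section \<open>Transitions of the implementing process\<close>

text \<open>
  An action on a channel in \<open>S\<close> belongs to a restricted channel, and has no counterpart.
\<close>

primrec reflected ::
  "('n, 'k) defs \<Rightarrow> 'n name set \<Rightarrow> ('n name \<Rightarrow> 'n name) \<Rightarrow> ('n \<Rightarrow> 'n name) \<Rightarrow> ('n, 'k) proc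
    \<Rightarrow> ('n, 'k) tccs \<Rightarrow> 'n name action \<Rightarrow> bool" where
  "reflected D S f \<tau> P E' (ATau M) \<longleftrightarrow> (match_map f M = [] \<longrightarrow>
     (\<exists>P'. pi_trans D P LTau P' \<and> impl D S f \<tau> E' P'))"
| "reflected D S f \<tau> P E' (AOut M m z) \<longleftrightarrow> (match_map f M = [] \<longrightarrow> f m \<notin> S \<longrightarrow>
     (\<exists>x\<in>fnames P. \<tau> x = f m \<and>
        ((\<exists>y P'. pi_trans D P (LOut x y) P' \<and> \<tau> y = f z \<and> impl D S f \<tau> E' P') \<or>
         (f z \<in> S \<and> (\<exists>W. finite W \<and> (\<forall>w. w \<notin> W \<longrightarrow>
            (\<exists>P'. pi_trans D P (LBOut x w) P' \<and> impl D (S - {f z}) f (\<tau>(w := f z)) E' P')))))))"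
| "reflected D S f \<tau> P E' (AIn M m z) \<longleftrightarrow> (match_map f M = [] \<longrightarrow> f m \<notin> S \<longrightarrow>
     (\<exists>x\<in>fnames P. \<tau> x = f m \<and> (\<exists>W. finite W \<and> (\<forall>w. w \<notin> W \<longrightarrow>
        (\<exists>P'. pi_trans D P (LIn x w) P' \<and> impl D S f (\<tau>(w := f z)) E' P')))))"

lemma reflected_Relabel:
  assumes g: "surj g" and refl: "reflected D S (f \<circ> g) \<tau> P E' a"
  shows "reflected D S f \<tau> P (Relabel E' (act_map g)) (act_map g a)"
  using refl
  \<comment> \<open>Both sides have the same logical structure and differ at the leaves stating
    \<open>impl\<close>. The connectives are peeled off until \<open>rel\<close> applies
    there.\<close>
  by (cases a; simp only: reflected.simps act_map.simps match_map_comp comp_apply Bex_def)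
    (elim imp_forward ex_forward conj_forward disj_forward all_forward;
      (assumption | erule impl.rel[OF g]))+

text \<open>An action on the restricted channel has its channel read as \<open>u\<close>, which is
  owned, so nothing is claimed about it. All other actions pass the restriction by
  \<open>res\<close> or, when they emit \<open>y\<close>, by \<open>opn\<close>.\<close>

lemma reflected_res:
  assumes u: "u \<in> S" and refl: "reflected D (S - {u}) f (\<tau>(y := u)) P E' a"
    and inf: "infinite (UNIV :: 'n set)"
  shows "reflected D S f \<tau> (Nu y (P :: ('n, 'k) proc)) E' a"
proof (cases a)
  case (ATau M)
  with refl u show ?thesis by (fastforce intro: impl.nu pi_trans.res)
next
  case (AOut M m z)
  show ?thesis
    unfolding AOut reflected.simps
  proof (intro impI)
    assume M: "match_map f M = []" and m: "f m \<notin> S"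
    then have "f m \<notin> S - {u}" by simp
    with refl AOut M obtain x where x: "x \<in> fnames P" "(\<tau>(y := u)) x = f m"
      and disj: "(\<exists>y' P'. pi_trans D P (LOut x y') P' \<and> (\<tau>(y := u)) y' = f z \<and>
          impl D (S - {u}) f (\<tau>(y := u)) E' P') \<or>
        (f z \<in> S - {u} \<and> (\<exists>W. finite W \<and> (\<forall>w. w \<notin> W \<longrightarrow> (\<exists>P'. pi_trans D P (LBOut x w) P' \<and>
          impl D (S - {u} - {f z}) f (\<tau>(y := u, w := f z)) E' P'))))"
      unfolding AOut reflected.simps by blast
    \<comment> \<open>The name \<open>y\<close> is read as \<open>u\<close>, which lies in
      \<open>S\<close>, but the channel does not.\<close>
    from x m u have xy: "x \<noteq> y" by auto
    from disj
    show "\<exists>x\<in>fnames (Nu y P). \<tau> x = f m \<and>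
        ((\<exists>y' P'. pi_trans D (Nu y P) (LOut x y') P' \<and> \<tau> y' = f z \<and> impl D S f \<tau> E' P') \<or>
         (f z \<in> S \<and> (\<exists>W. finite W \<and> (\<forall>w. w \<notin> W \<longrightarrow> (\<exists>P'. pi_trans D (Nu y P) (LBOut x w) P' \<and>
            impl D (S - {f z}) f (\<tau>(w := f z)) E' P')))))"
    proof (intro bexI[of _ x] conjI, goal_cases)
      case 2
      then consider (free) y' P' where "pi_trans D P (LOut x y') P'" "(\<tau>(y := u)) y' = f z"
          "impl D (S - {u}) f (\<tau>(y := u)) E' P'" "y' \<noteq> y"
        | (opn) P' where "pi_trans D P (LOut x y) P'" "u = f z"
          "impl D (S - {u}) f (\<tau>(y := u)) E' P'"
        | (bound) W where "f z \<in> S - {u}" "finite W" "\<And>w. w \<notin> W \<Longrightarrow>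
          \<exists>P'. pi_trans D P (LBOut x w) P' \<and> impl D (S - {u} - {f z}) f (\<tau>(y := u, w := f z)) E' P'"
        by (metis fun_upd_same)
      then show ?case
      proof cases
        case free
        then have "pi_trans D (Nu y P) (LOut x y') (Nu y P')"
          using xy by (intro pi_trans.res) auto
        with free u show ?thesis by (metis fun_upd_other impl.nu)
      next
        case opn
        \<comment> \<open>The free names of the restricted derivative form the finite set of
          exceptions.\<close>
        have "pi_trans D (Nu y P) (LBOut x w) (subst1 P' w y) \<and>
            impl D (S - {f z}) f (\<tau>(w := f z)) E' (subst1 P' w y)" if "w \<notin> fnames (Nu y P')" for w
          using opn xy that by (auto intro!: pi_trans.opn impl_subst1_fresh[OF inf])
        with opn u show ?thesis by (metis finite_fnames)
      next
        case bound
        \<comment> \<open>Adding \<open>y\<close> to the exceptions meets the side condition of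
          \<open>res\<close> and makes the updates of the reading commute.\<close>
        have "\<exists>P''. pi_trans D (Nu y P) (LBOut x w) P'' \<and> impl D (S - {f z}) f (\<tau>(w := f z)) E' P''"
          if w: "w \<notin> insert y W" for w
        proof -
          obtain P' where P': "pi_trans D P (LBOut x w) P'"
            "impl D (S - {u} - {f z}) f (\<tau>(y := u, w := f z)) E' P'"
            using bound(3) w by auto
          have "impl D (S - {f z} - {u}) f (\<tau>(w := f z, y := u)) E' P'"
            using P'(2) fun_upd_twist[of y w \<tau> u "f z"] w
            by (auto simp: Diff_insert2[symmetric] insert_commute)
          with u bound(1) have "impl D (S - {f z}) f (\<tau>(w := f z)) E' (Nu y P')"
            by (intro impl.nu[of u]) auto
          moreover have "pi_trans D (Nu y P) (LBOut x w) (Nu y P')"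
            using P'(1) xy w by (intro pi_trans.res) auto
          ultimately show ?thesis by blast
        qed
        with bound(1,2) show ?thesis by (metis DiffD1 finite.insertI)
      qed
    qed (use x xy in auto)
  qed
next
  case (AIn M m z)
  show ?thesis
    unfolding AIn reflected.simps
  proof (intro impI)
    assume M: "match_map f M = []" and m: "f m \<notin> S"
    then have "f m \<notin> S - {u}" by simp
    with refl AIn M obtain x W where x: "x \<in> fnames P" "(\<tau>(y := u)) x = f m" and W: "finite W"
      "\<And>w. w \<notin> W \<Longrightarrow> \<exists>P'. pi_trans D P (LIn x w) P' \<and> impl D (S - {u}) f (\<tau>(y := u, w := f z)) E' P'"
      unfolding AIn reflected.simps by blast
    from x m u have xy: "x \<noteq> y" by auto
    have "\<exists>P''. pi_trans D (Nu y P) (LIn x w) P'' \<and> impl D S f (\<tau>(w := f z)) E' P''"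
      if w: "w \<notin> insert y W" for w
    proof -
      obtain P' where P': "pi_trans D P (LIn x w) P'"
        "impl D (S - {u}) f (\<tau>(y := u, w := f z)) E' P'"
        using W(2) w by auto
      then have "impl D S f (\<tau>(w := f z)) E' (Nu y P')"
        using w u by (intro impl.nu[of u]) (auto simp: fun_upd_twist[of y w])
      moreover have "pi_trans D (Nu y P) (LIn x w) (Nu y P')"
        using P'(1) xy w by (intro pi_trans.res) auto
      ultimately show ?thesis by blast
    qed
    moreover have "finite (insert y W)" using W(1) by simp
    moreover have "x \<in> fnames (Nu y P)" "\<tau> x = f m" using x xy by auto
    ultimately show "\<exists>x\<in>fnames (Nu y P). \<tau> x = f m \<and> (\<exists>W. finite W \<and> (\<forall>w. w \<notin> W \<longrightarrow>
        (\<exists>P'. pi_trans D (Nu y P) (LIn x w) P' \<and> impl D S f (\<tau>(w := f z)) E' P')))"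
      by blast
  qed
qed

text \<open>The set \<open>B\<close> holds the names that a bound name must avoid, such as the free
  names of an idle component. Being finite, it can be added to any set of exceptions
  \<open>W\<close>; this is why \<open>reflected\<close> asks for almost all \<open>w\<close>
  only.\<close>

lemma reflected_context:
  assumes refl: "reflected D S1 f \<tau> P E' a" and S: "S1 \<subseteq> S" and B: "finite B"
    and fn: "fnames P \<subseteq> fnames R"
    and step: "\<And>\<alpha> P'. pi_trans D P \<alpha> P' \<Longrightarrow> bn \<alpha> \<inter> B = {} \<Longrightarrow> pi_trans D R \<alpha> (C P')"
    and impl: "\<And>T \<tau>' P'. \<lbrakk>impl D (S1 - T) f \<tau>' E' P'; T \<subseteq> S1; \<forall>x\<in>B. \<tau>' x = \<tau> x\<rbrakk>
      \<Longrightarrow> impl D (S - T) f \<tau>' G' (C P')"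
  shows "reflected D S f \<tau> R G' a"
proof (cases a)
  case (ATau M)
  have "\<exists>R'. pi_trans D R LTau R' \<and> impl D S f \<tau> G' R'"
    if "pi_trans D P LTau P'" "impl D S1 f \<tau> E' P'" for P'
    using step[OF that(1)] impl[of "{}" \<tau> P'] that(2) by auto
  with refl show ?thesis
    unfolding ATau reflected.simps by blast
next
  case (AOut M m z)
  have free: "\<exists>R'. pi_trans D R (LOut x y) R' \<and> impl D S f \<tau> G' R'"
    if "pi_trans D P (LOut x y) P'" "impl D S1 f \<tau> E' P'" for x y P'
    using step[OF that(1)] impl[of "{}" \<tau> P'] that(2) by auto
  have bound: "\<exists>R'. pi_trans D R (LBOut x w) R' \<and> impl D (S - {f z}) f (\<tau>(w := f z)) G' R'"
    if ex: "\<exists>P'. pi_trans D P (LBOut x w) P' \<and> impl D (S1 - {f z}) f (\<tau>(w := f z)) E' P'"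
      and z: "f z \<in> S1" and w: "w \<notin> B" for x w
  proof -
    obtain P' where P': "pi_trans D P (LBOut x w) P'"
      "impl D (S1 - {f z}) f (\<tau>(w := f z)) E' P'"
      using ex by blast
    have "\<forall>x\<in>B. (\<tau>(w := f z)) x = \<tau> x" using w by auto
    with step[OF P'(1)] impl[OF P'(2)] z w show ?thesis by auto
  qed
  show ?thesis
    unfolding AOut reflected.simps
  proof (intro impI)
    assume M: "match_map f M = []" and m: "f m \<notin> S"
    with S have "f m \<notin> S1" by auto
    with refl AOut M obtain x where x: "x \<in> fnames P" "\<tau> x = f m"
      and "(\<exists>y P'. pi_trans D P (LOut x y) P' \<and> \<tau> y = f z \<and> impl D S1 f \<tau> E' P') \<or>
        (f z \<in> S1 \<and> (\<exists>W. finite W \<and> (\<forall>w. w \<notin> W \<longrightarrow> (\<exists>P'. pi_trans D P (LBOut x w) P' \<and>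
          impl D (S1 - {f z}) f (\<tau>(w := f z)) E' P'))))" (is "?free \<or> ?bound")
      by auto
    from this(3) have "(\<exists>y R'. pi_trans D R (LOut x y) R' \<and> \<tau> y = f z \<and> impl D S f \<tau> G' R') \<or>
        (f z \<in> S \<and> (\<exists>W. finite W \<and> (\<forall>w. w \<notin> W \<longrightarrow> (\<exists>R'. pi_trans D R (LBOut x w) R' \<and>
          impl D (S - {f z}) f (\<tau>(w := f z)) G' R'))))" (is "_ \<or> ?bound'")
    proof
      assume ?free
      then obtain y P' where P': "pi_trans D P (LOut x y) P'" "\<tau> y = f z" "impl D S1 f \<tau> E' P'"
        by blast
      with free[OF P'(1,3)] show ?thesis by blast
    next
      assume ?bound
      then obtain W where W: "finite W" "f z \<in> S1" "\<And>w. w \<notin> W \<Longrightarrow> \<exists>P'. pi_trans D P (LBOut x w) P' \<and>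
          impl D (S1 - {f z}) f (\<tau>(w := f z)) E' P'"
        by blast
      have "finite (W \<union> B)" using W(1) B by simp
      moreover have "f z \<in> S" using W(2) S by auto
      moreover have "\<forall>w. w \<notin> W \<union> B \<longrightarrow>
          (\<exists>R'. pi_trans D R (LBOut x w) R' \<and> impl D (S - {f z}) f (\<tau>(w := f z)) G' R')"
        using bound[OF W(3) W(2)] by blast
      ultimately have ?bound' by blast
      then show ?thesis ..
    qed
    with x fn show "\<exists>x\<in>fnames R. \<tau> x = f m \<and>
        ((\<exists>y R'. pi_trans D R (LOut x y) R' \<and> \<tau> y = f z \<and> impl D S f \<tau> G' R') \<or>
         (f z \<in> S \<and> (\<exists>W. finite W \<and> (\<forall>w. w \<notin> W \<longrightarrow> (\<exists>R'. pi_trans D R (LBOut x w) R' \<and>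
            impl D (S - {f z}) f (\<tau>(w := f z)) G' R')))))"
      by (intro bexI[of _ x] conjI) (simp_all only: subsetD)
  qed
next
  case (AIn M m z)
  show ?thesis
    unfolding AIn reflected.simps
  proof (intro impI)
    assume M: "match_map f M = []" and m: "f m \<notin> S"
    with S have "f m \<notin> S1" by auto
    with refl AIn M obtain x W where x: "x \<in> fnames P" "\<tau> x = f m" and W: "finite W"
      "\<And>w. w \<notin> W \<Longrightarrow> \<exists>P'. pi_trans D P (LIn x w) P' \<and> impl D S1 f (\<tau>(w := f z)) E' P'"
      by auto
    have "\<exists>R'. pi_trans D R (LIn x w) R' \<and> impl D S f (\<tau>(w := f z)) G' R'" if w: "w \<notin> W \<union> B" for w
    proof -
      obtain P' where P': "pi_trans D P (LIn x w) P'" "impl D S1 f (\<tau>(w := f z)) E' P'"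
        using W(2) w by auto
      have "\<forall>x\<in>B. (\<tau>(w := f z)) x = \<tau> x" using w by auto
      with step[OF P'(1)] impl[of "{}" "\<tau>(w := f z)" P'] P'(2) w show ?thesis by auto
    qed
    moreover have "finite (W \<union> B)" using W(1) B by simp
    ultimately show "\<exists>x\<in>fnames R. \<tau> x = f m \<and> (\<exists>W. finite W \<and> (\<forall>w. w \<notin> W \<longrightarrow>
        (\<exists>R'. pi_trans D R (LIn x w) R' \<and> impl D S f (\<tau>(w := f z)) G' R')))"
      using x fn by blast
  qed
qed

lemma reflected_mono:
  assumes "reflected D S f \<tau> P E' a" and "\<And>\<alpha> P'. pi_trans D P \<alpha> P' \<Longrightarrow> pi_trans D Q \<alpha> P'"
    and "fnames P \<subseteq> fnames Q"
  shows "reflected D S f \<tau> Q E' a"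
  by (rule reflected_context[where B = "{}" and C = "\<lambda>P'. P'", OF assms(1)]) (use assms in auto)

lemma reflected_par1:
  assumes "reflected D S1 f \<tau> P E' a" and "impl D S2 f \<tau> F Q"
    and "S1 \<inter> S2 = {}" "S1 \<union> S2 \<subseteq> S"
  shows "reflected D S f \<tau> (Par P Q) (CPar E' F) a"
  using assms(1)
proof (rule reflected_context[where B = "fnames Q" and C = "\<lambda>P'. Par P' Q"])
  fix T \<tau>' P' assume "impl D (S1 - T) f \<tau>' E' P'" "T \<subseteq> S1" "\<forall>x\<in>fnames Q. \<tau>' x = \<tau> x"
  with assms show "impl D (S - T) f \<tau>' (CPar E' F) (Par P' Q)"
    by (intro impl_par_upd(1)[of D S1 _ _ _ _ _ S2 \<tau>]) auto
qed (use assms in \<open>auto intro: pi_trans.par1\<close>)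

lemma reflected_par2:
  assumes "reflected D S2 f \<tau> Q F' a" and "impl D S1 f \<tau> E P"
    and "S1 \<inter> S2 = {}" "S1 \<union> S2 \<subseteq> S"
  shows "reflected D S f \<tau> (Par P Q) (CPar E F') a"
  using assms(1)
proof (rule reflected_context[where B = "fnames P" and C = "Par P"])
  fix T \<tau>' Q' assume "impl D (S2 - T) f \<tau>' F' Q'" "T \<subseteq> S2" "\<forall>x\<in>fnames P. \<tau>' x = \<tau> x"
  with assms show "impl D (S - T) f \<tau>' (CPar E F') (Par P Q')"
    by (intro impl_par_upd(2)[of D S2 _ _ _ _ _ S1 \<tau>]) auto
qed (use assms in \<open>auto intro: pi_trans.par2\<close>)

section \<open>Separation of free names from owned names, and communication\<close>

definition separated :: "'n name set \<Rightarrow> ('n \<Rightarrow> 'n name) \<Rightarrow> 'n set \<Rightarrow> bool" where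
  "separated S \<tau> A \<longleftrightarrow> inj_on \<tau> A \<and> \<tau> ` A \<inter> S = {}"

lemma separated_subset:
  assumes "separated S \<tau> A" and "B \<subseteq> A" and "T \<subseteq> S"
  shows "separated T \<tau> B"
proof -
  have "inj_on \<tau> B"
    using assms(1,2) unfolding separated_def by (metis inj_on_subset)
  moreover have "\<tau> ` B \<inter> T = {}"
    using assms unfolding separated_def by auto
  ultimately show ?thesis unfolding separated_def ..
qed

text \<open>The value \<open>u\<close> given to \<open>y\<close> clashes with no other reading,
  since those avoid \<open>S\<close>, and it leaves the owned names at the same moment.\<close>

lemma separated_nu:
  assumes "separated S \<tau> (A - {y})" and "u \<in> S"
  shows "separated (S - {u}) (\<tau>(y := u)) A"
proof -
  have ne: "\<tau> x \<notin> S" "\<tau> x \<noteq> u" if "x \<in> A" "x \<noteq> y" for x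
    using assms that unfolding separated_def by auto
  have "x = x'" if "x \<in> A" "x' \<in> A" "(\<tau>(y := u)) x = (\<tau>(y := u)) x'" for x x'
    using assms(1) that ne[of x] ne[of x'] unfolding separated_def
    by (auto dest: inj_onD split: if_splits)
  with ne show ?thesis
    unfolding separated_def by (auto intro: inj_onI)
qed

text \<open>
  The disjoint ownership makes the two partners meet on the image of a free name, and injectivity
  makes it the same name on both sides.
\<close>

lemma reflected_com:
  assumes inf: "infinite (UNIV :: 'n set)"
    and out: "reflected D S1 f \<tau> (P :: ('n, 'k) proc) E' (AOut M m z)"
    and inp: "reflected D S2 f \<tau> Q F' (AIn N n z)"
    and S: "S1 \<inter> S2 = {}" "S1 \<union> S2 \<subseteq> S" and sep: "separated S \<tau> (fnames P \<union> fnames Q)"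
    and match: "match_map f M = []" "match_map f N = []" "f m = f n"
  shows "\<exists>R'. pi_trans D (Par P Q) LTau R' \<and> impl D S f \<tau> (CPar E' F') R'"
    and "\<exists>R'. pi_trans D (Par Q P) LTau R' \<and> impl D S f \<tau> (CPar F' E') R'"
proof -
  let ?free = "\<lambda>x. \<exists>y P'. pi_trans D P (LOut x y) P' \<and> \<tau> y = f z \<and> impl D S1 f \<tau> E' P'"
  let ?bound = "\<lambda>x. f z \<in> S1 \<and> (\<exists>W. finite W \<and> (\<forall>w. w \<notin> W \<longrightarrow> (\<exists>P'. pi_trans D P (LBOut x w) P' \<and>
          impl D (S1 - {f z}) f (\<tau>(w := f z)) E' P')))"
  have o: "f m \<notin> S1 \<Longrightarrow> \<exists>x\<in>fnames P. \<tau> x = f m \<and> (?free x \<or> ?bound x)"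
    using out match by simp
  have i: "f m \<notin> S2 \<Longrightarrow> \<exists>x\<in>fnames Q. \<tau> x = f m \<and> (\<exists>W. finite W \<and> (\<forall>w. w \<notin> W \<longrightarrow>
        (\<exists>P'. pi_trans D Q (LIn x w) P' \<and> impl D S2 f (\<tau>(w := f z)) F' P')))"
    using inp match by simp
  \<comment> \<open>A channel owned by one partner is not owned by the other, for which it must then
    be the reading of a free name, against separation.\<close>
  have "f m \<notin> S1"
  proof
    assume m: "f m \<in> S1"
    with S have "f m \<notin> S2" by auto
    with i obtain x where "x \<in> fnames Q" "\<tau> x = f m" by blast
    with m S sep show False by (force simp: separated_def)
  qed
  moreover have "f m \<notin> S2"
  proof
    assume m: "f m \<in> S2"
    with S have "f m \<notin> S1" by auto
    with o obtain x where "x \<in> fnames P" "\<tau> x = f m" by blast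
    with m S sep show False by (force simp: separated_def)
  qed
  ultimately obtain x x' W where x: "x \<in> fnames P" "\<tau> x = f m" "?free x \<or> ?bound x"
    and x': "x' \<in> fnames Q" "\<tau> x' = f m" and W: "finite W"
      "\<And>w. w \<notin> W \<Longrightarrow> \<exists>Q'. pi_trans D Q (LIn x' w) Q' \<and> impl D S2 f (\<tau>(w := f z)) F' Q'"
    using o i by blast
  have "x' = x"
    using sep x(1,2) x' unfolding separated_def inj_on_def by simp
  note W = W[unfolded this]
  have "(\<exists>R'. pi_trans D (Par P Q) LTau R' \<and> impl D S f \<tau> (CPar E' F') R') \<and>
      (\<exists>R'. pi_trans D (Par Q P) LTau R' \<and> impl D S f \<tau> (CPar F' E') R')"
    using x(3)
  proof
    assume "?free x"
    then obtain y P' where P': "pi_trans D P (LOut x y) P'" "\<tau> y = f z" "impl D S1 f \<tau> E' P'"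
      by blast
    obtain w where "w \<notin> W" using W(1) inf by (metis ex_new_if_finite)
    then obtain Q' where Q': "pi_trans D Q (LIn x w) Q'" "impl D S2 f (\<tau>(w := \<tau> y)) F' Q'"
      using W(2) P'(2) by metis
    from pi_trans.com1[OF P'(1) Q'(1)] pi_trans.com2[OF Q'(1) P'(1)]
      impl_par_receive[OF inf P'(3) Q'(2) S]
    show ?thesis by blast
  next
    assume "?bound x"
    then obtain W' where W': "f z \<in> S1" "finite W'" "\<And>w. w \<notin> W' \<Longrightarrow>
        \<exists>P'. pi_trans D P (LBOut x w) P' \<and> impl D (S1 - {f z}) f (\<tau>(w := f z)) E' P'"
      by blast
    \<comment> \<open>The close rules demand the same bound name on both sides; only finitely many
      names are excluded.\<close>
    obtain w where "w \<notin> W \<union> W'" using W(1) W'(2) inf by (metis ex_new_if_finite finite_Un)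
    then obtain P' Q' where P': "pi_trans D P (LBOut x w) P'"
        "impl D (S1 - {f z}) f (\<tau>(w := f z)) E' P'"
      and Q': "pi_trans D Q (LIn x w) Q'" "impl D S2 f (\<tau>(w := f z)) F' Q'"
      using W(2) W'(3) by blast
    from pi_trans.close1[OF P'(1) Q'(1)] pi_trans.close2[OF Q'(1) P'(1)]
      impl_par_close[OF P'(2) Q'(2) W'(1) S]
    show ?thesis by blast
  qed
  then show "\<exists>R'. pi_trans D (Par P Q) LTau R' \<and> impl D S f \<tau> (CPar E' F') R'"
    and "\<exists>R'. pi_trans D (Par Q P) LTau R' \<and> impl D S f \<tau> (CPar F' E') R'"
    by blast+
qed

lemma reflected_comm:
  assumes inf: "infinite (UNIV :: 'n set)"
    and E: "reflected D S1 f \<tau> (P :: ('n, 'k) proc) E' a" and F: "reflected D S2 f \<tau> Q F' b"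
    and c: "gam a b = Some c"
    and S: "S1 \<inter> S2 = {}" "S1 \<union> S2 \<subseteq> S" and sep: "separated S \<tau> (fnames P \<union> fnames Q)"
  shows "reflected D S f \<tau> (Par P Q) (CPar E' F') c"
  using c E F
proof (induction a b rule: gam.induct)
  case (1 M x y N v y')
  then have c: "c = ATau (add_match x v (M @ N))" and y: "y' = y"
    by (auto split: if_splits)
  show ?case
    unfolding c reflected.simps match_map_add_match
    using reflected_com(1)[OF inf 1(2) 1(3)[unfolded y] S sep] by auto
next
  case (2 N v y' M x y)
  then have c: "c = ATau (add_match x v (M @ N))" and y: "y' = y"
    by (auto split: if_splits)
  have "S2 \<inter> S1 = {}" "S2 \<union> S1 \<subseteq> S" "separated S \<tau> (fnames Q \<union> fnames P)"
    using S sep by (simp_all add: ac_simps)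
  from reflected_com(2)[OF inf 2(3) 2(2)[unfolded y] this] show ?case
    unfolding c reflected.simps match_map_add_match by auto
qed auto

text \<open>Unfolding the three sums to the constructor \<open>Sum\<close> exposes the clashes of
  shape in the inner inductions below.\<close>

lemmas sum_defs = empty_sum_def binary_sum_def name_sum_def

text \<open>Rule induction on the target transition, with an inner induction on \<open>impl\<close>.
  The shape of the target process leaves its structural rules and \<open>nu\<close>, which changes
  only the source side and is settled each time by \<open>reflected_res\<close> and
  \<open>separated_nu\<close>.\<close>

lemma impl_reflects:
  assumes inf: "infinite (UNIV :: 'n set)" and wf: "wf_defs (D :: ('n, 'k) defs)"
  shows "cstep D E a E' \<Longrightarrow> impl D S f \<tau> E P \<Longrightarrow> separated S \<tau> (fnames P) \<Longrightarrow> reflected D S f \<tau> P E' a"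
proof (induction arbitrary: S f \<tau> P rule: ccs_trans.induct)
  case (prefix a E)
  from prefix.prems show ?case
  proof (induction S f \<tau> "Prefix a E" P rule: impl.induct)
    case (tau M M' f \<tau> S P)
    \<comment> \<open>Both sequences have the same image, and the reading is injective on the names
      of \<open>M'\<close>.\<close>
    have "M' = []" if "match_map f M = []"
      using tau that by (intro match_map_inj_Nil[of _ \<tau>]) (auto simp: separated_def inj_on_Un)
    with tau.hyps show ?case by auto (blast intro: pi_trans.tau)
  next
    case (out M M' f \<tau> m x z y S P)
    have "M' = []" if "match_map f M = []"
      using out that by (intro match_map_inj_Nil[of _ \<tau>])
        (auto simp: separated_def intro: inj_on_subset)
    then have "pi_trans D (OutPre M' x y P) (LOut x y) P" if "match_map f M = []"
      using that by (simp add: pi_trans.out)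
    with out.hyps(4-6) have "reflected D S f \<tau> (OutPre M' x y P) E (AOut M m z)"
      unfolding reflected.simps by (intro impI bexI[of _ x]) auto
    with out.hyps show ?case by simp
  qed (auto simp: sum_defs intro: reflected_res[OF _ _ inf] separated_nu)
next
  case (sum F i E a E')
  note IH = sum.IH and F = sum.hyps
  from sum.prems show ?case
  proof (induction S f \<tau> "Sum F" P rule: impl.induct)
    case (inp M M' f \<tau> m x S y E0 P)
    have M': "M' = []" if "match_map f M = []"
      using inp that by (intro match_map_inj_Nil[of _ \<tau>])
        (auto simp: separated_def intro: inj_on_subset)
    obtain z where "cstep D (Prefix (AIn M m z) (E0 z)) a E'"
      using F inp.hyps(7) by (auto simp: name_sum_def split: sum.splits)
    then have a: "a = AIn M m z" "E' = E0 z"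
      by (auto elim: ccs_trans.cases)
    have "pi_trans D (InPre [] x y P) (LIn x w) (subst1 P w y) \<and>
        impl D S f (\<tau>(w := f z)) (E0 z) (subst1 P w y)" if "w \<notin> fnames (Nu y P)" for w
      using that inp.hyps(5) by (auto intro: pi_trans.inp impl_subst1_fresh[OF inf])
    then show ?case
      unfolding a reflected.simps
      using M' inp.hyps(4) by (intro impI bexI[of _ x] conjI exI[of _ "fnames (Nu y P)"]) auto
  next
    case (plus S f \<tau> E1 P E2 Q)
    then consider "E = E1" | "E = E2"
      using F(1) by (auto simp: binary_sum_def split: sum.splits if_splits)
    then show ?case
    proof cases
      case 1
      have "reflected D S f \<tau> P E' a"
        using plus.hyps(1) 1 by (intro IH separated_subset[OF plus.prems]) auto
      then show ?thesis by (rule reflected_mono) (auto intro: pi_trans.sum1)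
    next
      case 2
      have "reflected D S f \<tau> Q E' a"
        using plus.hyps(3) 2 by (intro IH separated_subset[OF plus.prems]) auto
      then show ?thesis by (rule reflected_mono) (auto intro: pi_trans.sum2)
    qed
  next
    case null
    then show ?case using F(1) by (auto simp: sum_defs)
  qed (auto simp: sum_defs intro: reflected_res[OF _ _ inf] separated_nu)
next
  case (left E a E' F)
  note IH = left.IH
  from left.prems show ?case
  proof (induction S f \<tau> "CPar E F" P rule: impl.induct)
    case (par S1 f \<tau> P S2 Q S)
    then have "reflected D S1 f \<tau> P E' a"
      by (intro IH separated_subset[OF par.prems]) auto
    from reflected_par1[OF this par.hyps(3,5,6)] show ?case .
  qed (auto simp: sum_defs intro: reflected_res[OF _ _ inf] separated_nu)
next
  case (right F a F' E)
  note IH = right.IH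
  from right.prems show ?case
  proof (induction S f \<tau> "CPar E F" P rule: impl.induct)
    case (par S1 f \<tau> P S2 Q S)
    then have "reflected D S2 f \<tau> Q F' a"
      by (intro IH separated_subset[OF par.prems]) auto
    from reflected_par2[OF this par.hyps(1,5,6)] show ?case .
  qed (auto simp: sum_defs intro: reflected_res[OF _ _ inf] separated_nu)
next
  case (comm E a E' F b F' c)
  note IH = comm.IH and c = comm.hyps(3)
  from comm.prems show ?case
  proof (induction S f \<tau> "CPar E F" P rule: impl.induct)
    case (par S1 f \<tau> P S2 Q S)
    then have "reflected D S1 f \<tau> P E' a"
      by (intro IH separated_subset[OF par.prems]) auto
    moreover have "reflected D S2 f \<tau> Q F' b"
      using par by (intro IH separated_subset[OF par.prems]) auto
    ultimately show ?case
      by (rule reflected_comm[OF inf]) (use c par in auto)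
  qed (auto simp: sum_defs intro: reflected_res[OF _ _ inf] separated_nu)
next
  case (relabel E a E' h)
  note IH = relabel.IH
  from relabel.prems show ?case
  proof (induction S f \<tau> "Relabel E h" P rule: impl.induct)
    case (rel g S f \<tau> P)
    from reflected_Relabel[OF rel.hyps(1) IH[OF rel.hyps(2) rel.prems]] rel.hyps
    show ?case by simp
  qed (auto simp: sum_defs intro: reflected_res[OF _ _ inf] separated_nu)
next
  case (ident A a E')
  note IH = ident.IH
  from ident.prems show ?case
  proof (induction S f \<tau> "Ident A :: ('n, 'k) tccs" P rule: impl.induct)
    case (call f S \<tau> ys)
    obtain xs P where A: "D A = (xs, P)" by force
    have len: "length ys = length xs"
      using call.hyps(3) A by (metis fst_conv length_map)
    have fn: "fnames (subst_list P xs ys) \<subseteq> set ys"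
      using wf A len by (rule fnames_subst_list)
    have "impl D S f \<tau> (transl_defs D A) (subst_list P xs ys)"
      using call.hyps A by (auto intro: impl_unfold[OF inf wf])
    with fn have "reflected D S f \<tau> (subst_list P xs ys) E' a"
      by (intro IH separated_subset[OF call.prems]) auto
    then show ?case
      by (rule reflected_mono) (use A fn in \<open>auto intro: pi_trans.ide\<close>)
  qed (auto simp: sum_defs intro: reflected_res[OF _ _ inf] separated_nu)
qed

section \<open>Strong barbed bisimilarity\<close>

text \<open>The outermost situation: the readings are public names, the owned names are
  private.\<close>

lemma separated_Name: "separated pool Name A"
  by (auto simp: separated_def pool_def inj_on_def)

lemma impl_red_forward:
  assumes inf: "infinite (UNIV :: 'n set)" and wf: "wf_defs (D :: ('n, 'k) defs)"
    and "impl D pool id Name E P" and "pi_red D P P'"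
  shows "\<exists>E'. ccs_red D E E' \<and> impl D pool id Name E' P'"
proof -
  from impl_simulates[OF inf wf] assms(3,4) have "simulated D pool id Name E P' LTau"
    unfolding pi_red_def by blast
  then show ?thesis
    \<comment> \<open>A proper sequence that vanishes under \<open>id\<close> is empty, so the step
      is a genuine reduction.\<close>
    by (auto simp: ccs_red_def match_map_id)
qed

lemma impl_red_backward:
  assumes inf: "infinite (UNIV :: 'n set)" and wf: "wf_defs (D :: ('n, 'k) defs)"
    and "impl D pool id Name E P" and "ccs_red D E E'"
  shows "\<exists>P'. pi_red D P P' \<and> impl D pool id Name E' P'"
proof -
  from impl_reflects[OF inf wf _ assms(3) separated_Name] assms(4)
  have "reflected D pool id Name P E' (ATau [])"
    unfolding ccs_red_def by blast
  then show ?thesis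
    by (auto simp: pi_red_def)
qed

lemma impl_barb:
  assumes inf: "infinite (UNIV :: 'n set)" and wf: "wf_defs (D :: ('n, 'k) defs)"
    and impl: "impl D pool id Name E P"
  shows "pi_barb D P b \<longleftrightarrow> ccs_barb D E b"
proof
  note sim = impl_simulates[OF inf wf _ impl]
  assume "pi_barb D P b"
  then show "ccs_barb D E b"
  proof (cases b)
    case (InBarb a)
    with \<open>pi_barb D P b\<close> obtain x y P' where x: "a = Name x" "pi_trans D P (LIn x y) P'"
      by auto
    from sim[OF x(2)] show ?thesis
      using InBarb x(1) by (fastforce simp: match_map_id public_def)
  next
    case (OutBarb a)
    with \<open>pi_barb D P b\<close> obtain x y P' where x: "a = Name x"
      "pi_trans D P (LOut x y) P' \<or> pi_trans D P (LBOut x y) P'"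
      by auto
    \<comment> \<open>Free and bound outputs both appear in the target as plain outputs on the same
      channel.\<close>
    from x(2) have "\<exists>M z E'. cstep D E (AOut M a z) E' \<and> proper M \<and> match_map id M = []"
      using sim[of "LOut x y" P'] sim[of "LBOut x y" P'] x(1) by auto
    then show ?thesis
      using OutBarb x(1) by (auto simp: match_map_id public_def) blast
  qed
next
  note refl = impl_reflects[OF inf wf _ impl separated_Name]
  assume "ccs_barb D E b"
  then show "pi_barb D P b"
  proof (cases b)
    case (InBarb a)
    with \<open>ccs_barb D E b\<close> obtain y E' where a: "a \<in> public" "cstep D E (AIn [] a y) E'"
      by auto
    \<comment> \<open>A public channel is not owned, so the action does have a source
      counterpart.\<close>
    have "a \<notin> pool" using a(1) by (auto simp: public_def pool_def)
    with refl[OF a(2)] obtain x W where "Name x = a" and W: "finite W"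
      "\<And>w. w \<notin> W \<Longrightarrow> \<exists>P'. pi_trans D P (LIn x w) P'"
      by auto metis
    moreover obtain w where "w \<notin> W" using W(1) inf by (metis ex_new_if_finite)
    ultimately show ?thesis using InBarb by auto blast
  next
    case (OutBarb a)
    with \<open>ccs_barb D E b\<close> obtain y E' where a: "a \<in> public" "cstep D E (AOut [] a y) E'"
      by auto
    have "a \<notin> pool" using a(1) by (auto simp: public_def pool_def)
    with refl[OF a(2)] obtain x where x: "Name x = a" and
      "(\<exists>y P'. pi_trans D P (LOut x y) P') \<or>
        (\<exists>W. finite W \<and> (\<forall>w. w \<notin> W \<longrightarrow> (\<exists>P'. pi_trans D P (LBOut x w) P')))"
      by auto metis
    then have "\<exists>y P'. pi_trans D P (LOut x y) P' \<or> pi_trans D P (LBOut x y) P'"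
      using inf by (metis ex_new_if_finite)
    with x OutBarb show ?thesis by auto
  qed
qed

theorem theorem2:
  fixes D :: "('n, 'k) defs" and P :: "('n, 'k) proc"
  assumes "infinite (UNIV :: 'n set)"
    and "wf_defs D"
    and "wf_proc D P"
  shows "barbed_bisimilar (union_red D) (union_barb D) (Inr (transl D P)) (Inl P)"
proof -
  \<comment> \<open>The relation must go beyond pairs of a process and its translation: a
    \<open>close\<close> step adds a source restriction with no matching relabelling in the
    target.\<close>
  define R :: "('n, 'k) state \<Rightarrow> ('n, 'k) state \<Rightarrow> bool" where
    "R = (\<lambda>s t. \<exists>E P. impl D pool id Name E P \<and> ((s = Inr E \<and> t = Inl P) \<or> (s = Inl P \<and> t = Inr E)))"
  have "barbed_bisimulation (union_red D) (union_barb D) R"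
    unfolding barbed_bisimulation_def
  proof (intro conjI allI impI)
    show "symp R" by (auto simp: R_def intro: sympI)
  next
    fix s t s' assume "R s t" and "union_red D s s'"
    then obtain E Q where "impl D pool id Name E Q"
      "(s = Inr E \<and> t = Inl Q) \<or> (s = Inl Q \<and> t = Inr E)"
      by (auto simp: R_def)
    with \<open>union_red D s s'\<close> show "\<exists>t'. union_red D t t' \<and> R s' t'"
      using impl_red_forward[OF assms(1,2), of E Q] impl_red_backward[OF assms(1,2), of E Q]
      by (auto simp: R_def elim!: union_red.cases) (blast intro: union_red.intros)+
  next
    fix s t b assume "R s t" and "union_barb D s b"
    then show "union_barb D t b"
      using impl_barb[OF assms(1,2)] by (auto simp: R_def)
  qed
  moreover have "impl D pool id (id \<circ> Name) (transl D P) P"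
    using assms(2,3) by (rule impl_transl) auto
  then have "R (Inr (transl D P)) (Inl P)"
    by (auto simp: R_def)
  ultimately show ?thesis
    unfolding barbed_bisimilar_def by blast
qed

end
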